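(* Let $n\ge 2$, let $\sigma\in S_n$ be a nontrivial permutation, and let $S=\mathscr M(S_n,2,2,C)$ be the Rees matrix semigroup over the symmetric group $S_n$ with sandwich matrix $C=\begin{bmatrix}1&1\\1&\sigma\end{bmatrix}$. Then the minimal degree of a faithful action of $S$ by either partial or total functions is $2n-|\mathrm{Fix}(\sigma)|$, except when $n=6$ and $\sigma$ is a derangement that is either a $6$-cycle, a product of two disjoint $3$-cycles, or a product of three disjoint $2$-cycles. In these exceptional cases the minimal degree is $11$, $9$ and $8$ respectively.
   Context: For a group $G$, finite sets $A,B$ and a matrix $C\colon B\times A\to G$, the Rees matrix semigroup $\mathscr M(G,A,B,C)$ is the set $A\times G\times B$ with product $(a,g,b)(a',g',b')=(a,gC_{ba'}g',b')$; here $A=B=\{1,2\}$. $\mathrm{Fix}(\sigma)$ is the set of fixed points of $\sigma$ in $\{1,\dots,n\}$. The minimal degree of a faithful action by partial (resp. total) functions is the least $m$ such that $S$ embeds in the monoid of partial (resp. total) maps of an $m$-element set acting on the right. *)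

theory Defs
  imports "HOL-Combinatorics.Permutations"
begin

(* Symmetric group S_n: permutations of {1..n}; product  g \<cdot> h = h \<circ> g
   (apply g first, matching right actions). *)

definition sandwich :: "(nat \<Rightarrow> nat) \<Rightarrow> nat \<Rightarrow> nat \<Rightarrow> (nat \<Rightarrow> nat)" where
  "sandwich \<sigma> b a = (if b = 2 \<and> a = 2 then \<sigma> else id)"

definition rees_carrier :: "nat \<Rightarrow> (nat \<times> (nat \<Rightarrow> nat) \<times> nat) set" where
  "rees_carrier n = {1,2} \<times> {g. g permutes {1..n}} \<times> {1,2}"

definition rees_mult :: "(nat \<Rightarrow> nat) \<Rightarrow> (nat \<times> (nat \<Rightarrow> nat) \<times> nat)
    \<Rightarrow> (nat \<times> (nat \<Rightarrow> nat) \<times> nat) \<Rightarrow> (nat \<times> (nat \<Rightarrow> nat) \<times> nat)" where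
  "rees_mult \<sigma> s t = (case s of (a, g, b) \<Rightarrow> case t of (a', g', b') \<Rightarrow>
      (a, g' \<circ> sandwich \<sigma> b a' \<circ> g, b'))"

definition partial_faithful_action ::
  "'s set \<Rightarrow> ('s \<Rightarrow> 's \<Rightarrow> 's) \<Rightarrow> nat set \<Rightarrow> ('s \<Rightarrow> nat \<Rightarrow> nat option) \<Rightarrow> bool" where
  "partial_faithful_action S mul X \<phi> \<longleftrightarrow>
     (\<forall>s\<in>S. \<forall>x\<in>X. \<forall>y. \<phi> s x = Some y \<longrightarrow> y \<in> X) \<and>
     (\<forall>s\<in>S. \<forall>t\<in>S. \<forall>x\<in>X. \<phi> (mul s t) x = Option.bind (\<phi> s x) (\<phi> t)) \<and>
     (\<forall>s\<in>S. \<forall>t\<in>S. s \<noteq> t \<longrightarrow> (\<exists>x\<in>X. \<phi> s x \<noteq> \<phi> t x))"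

definition total_faithful_action ::
  "'s set \<Rightarrow> ('s \<Rightarrow> 's \<Rightarrow> 's) \<Rightarrow> nat set \<Rightarrow> ('s \<Rightarrow> nat \<Rightarrow> nat) \<Rightarrow> bool" where
  "total_faithful_action S mul X \<phi> \<longleftrightarrow>
     (\<forall>s\<in>S. \<forall>x\<in>X. \<phi> s x \<in> X) \<and>
     (\<forall>s\<in>S. \<forall>t\<in>S. \<forall>x\<in>X. \<phi> (mul s t) x = \<phi> t (\<phi> s x)) \<and>
     (\<forall>s\<in>S. \<forall>t\<in>S. s \<noteq> t \<longrightarrow> (\<exists>x\<in>X. \<phi> s x \<noteq> \<phi> t x))"

definition min_partial_degree :: "'s set \<Rightarrow> ('s \<Rightarrow> 's \<Rightarrow> 's) \<Rightarrow> nat" where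
  "min_partial_degree S mul = (LEAST m. \<exists>X \<phi>. finite X \<and> card X = m \<and> partial_faithful_action S mul X \<phi>)"

definition min_total_degree :: "'s set \<Rightarrow> ('s \<Rightarrow> 's \<Rightarrow> 's) \<Rightarrow> nat" where
  "min_total_degree S mul = (LEAST m. \<exists>X \<phi>. finite X \<and> card X = m \<and> total_faithful_action S mul X \<phi>)"

definition Fix :: "nat \<Rightarrow> (nat \<Rightarrow> nat) \<Rightarrow> nat set" where
  "Fix n \<sigma> = {i \<in> {1..n}. \<sigma> i = i}"

definition all_cycles_of_length :: "nat \<Rightarrow> (nat \<Rightarrow> nat) \<Rightarrow> nat \<Rightarrow> bool" where
  "all_cycles_of_length n \<sigma> k \<longleftrightarrow>
     (\<forall>x\<in>{1..n}. (\<sigma> ^^ k) x = x \<and> (\<forall>j. 0 < j \<and> j < k \<longrightarrow> (\<sigma> ^^ j) x \<noteq> x))"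

end

theory Submission
  imports Defs
begin

text \<open>If the semigroup acts faithfully on \<open>X\<close>, then the symmetric group acts faithfully on the
  image \<open>Y\<close> of the idempotent \<open>(1, id, 1)\<close>, and \<open>(1, id, 2)\<close> maps \<open>Y\<close> injectively to a second copy
  of \<open>Y\<close> that can meet \<open>Y\<close> only in fixed points of \<open>\<sigma>\<close>. Conversely, gluing two copies of a faithful
  \<open>S\<^sub>n\<close>-set along the fixed points of \<open>\<sigma>\<close> yields a faithful total action. So both degrees are the
  minimum of \<open>|Y|\<close> plus the number of points of \<open>Y\<close> moved by \<open>\<sigma>\<close>, over all faithful \<open>S\<^sub>n\<close>-sets \<open>Y\<close>.

  For \<open>n \<ge> 7\<close>, Bochert's argument shows that a point stabiliser of index below \<open>2n - 2\<close> contains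
  a 3-cycle; the blocks spanned by its 3-cycles then force it to fix a point of \<open>{1..n}\<close> or to contain
  the alternating group, so that \<open>Y\<close> moves at least as many points as the natural action. For
  \<open>n \<le> 6\<close> the order and the sign of \<open>\<sigma>\<close> on \<open>Y\<close> give the bound, and in the exceptional cases it is attained
  by the action of \<open>S\<^sub>6\<close> on the six synthematic totals.\<close>

section \<open>Actions of the Rees matrix semigroup and of the symmetric group\<close>

definition supp :: "('a \<Rightarrow> 'a) \<Rightarrow> 'a set" where
  "supp f = {x. f x \<noteq> x}"

lemma supp_permutes_subset: "f permutes A \<Longrightarrow> supp f \<subseteq> A"
  using permutes_not_in[of f A] unfolding supp_def by blast

lemma in_supp_iff: "x \<in> supp f \<longleftrightarrow> f x \<noteq> x"
  by (simp add: supp_def)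

lemma image_in_supp: "inj f \<Longrightarrow> f x \<in> supp f \<longleftrightarrow> x \<in> supp f"
  by (auto simp: supp_def inj_eq)

text \<open>Each \<open>\<theta> g\<close> is the identity outside \<open>Y\<close>, so equations
  between these maps hold on the whole type, and their powers, supports and signs can be used
  without restricting to \<open>Y\<close>.\<close>

locale faithful_sym_action =
  fixes n :: nat and Y :: "'a set" and \<theta> :: "(nat \<Rightarrow> nat) \<Rightarrow> 'a \<Rightarrow> 'a"
  assumes finite_Y: "finite Y"
    and permutes_Y: "g permutes {1..n} \<Longrightarrow> \<theta> g permutes Y"
    and comp: "g permutes {1..n} \<Longrightarrow> h permutes {1..n} \<Longrightarrow> \<theta> (g \<circ> h) = \<theta> g \<circ> \<theta> h"
    and faithful: "g permutes {1..n} \<Longrightarrow> \<theta> g = id \<Longrightarrow> g = id"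
begin

lemma theta_id [simp]: "\<theta> id = id"
proof -
  have "inj (\<theta> id)" using permutes_Y permutes_id permutes_inj by blast
  moreover have "\<theta> id \<circ> \<theta> id = \<theta> id"
    using comp[of id id] permutes_id by simp
  ultimately show ?thesis
    by (auto simp: fun_eq_iff inj_def)
qed

lemma eqD: 
  assumes "g permutes {1..n}" "h permutes {1..n}" "\<theta> g = \<theta> h"
  shows "g = h"
proof -
  have i: "inv h permutes {1..n}" using assms(2) by (rule permutes_inv)
  have "\<theta> (inv h \<circ> g) = \<theta> (inv h \<circ> h)"
    using assms by (simp add: comp[OF i])
  also have "\<dots> = id" using assms(2) by (simp add: permutes_inv_o)
  finally have "inv h \<circ> g = id"
    using faithful permutes_compose[OF assms(1) i] by blast
  then have "inv h (g x) = inv h (h x)" for x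
    using assms(2) by (simp add: fun_eq_iff permutes_inverses)
  then show ?thesis
    using injD[OF permutes_inj[OF i]] by blast
qed

lemma supp_subset: "g permutes {1..n} \<Longrightarrow> supp (\<theta> g) \<subseteq> Y"
  using permutes_Y permutes_not_in by (fastforce simp: supp_def)

lemma finite_supp: "g permutes {1..n} \<Longrightarrow> finite (supp (\<theta> g))"
  using supp_subset finite_Y finite_subset by blast

end

lemma faithful_sym_action_natural: "faithful_sym_action n {1..n} (\<lambda>g. g)"
  by unfold_locales auto

text \<open>The triples \<open>(1,g,1)\<close> form a copy of the symmetric group with identity
  \<open>e\<close>, because the matrix entry for \<open>b = 1\<close>, \<open>a = 1\<close> is
  \<open>id\<close>. They therefore permute the image of \<open>e\<close>.\<close>

lemma faithful_sym_action_of_partial: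
  assumes "finite X" and act: "partial_faithful_action (rees_carrier n) (rees_mult \<sigma>) X \<phi>"
    and \<sigma>: "\<sigma> permutes {1..n}"
  obtains Y :: "nat set" and \<theta> where "faithful_sym_action n Y \<theta>" "card Y + card (supp (\<theta> \<sigma>)) \<le> card X"
proof -
  define e where "e = (1::nat, id::nat\<Rightarrow>nat, 1::nat)"
  define Y where "Y = {x\<in>X. \<phi> e x = Some x}"
  \<comment> \<open>On \<open>Y\<close> the value is always defined, by \<open>Y_act\<close> through
    the inverse of \<open>g\<close>. Off \<open>Y\<close> the default is the identity, as
    \<open>permutes\<close> demands.\<close>
  define \<theta> where "\<theta> g y = (if y \<in> Y then the (\<phi> (1,g,1) y) else y)" for g y
  have car: "(a,g,b) \<in> rees_carrier n \<longleftrightarrow> a \<in> {1,2} \<and> g permutes {1..n} \<and> b \<in> {1,2}" for a g b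
    by (auto simp: rees_carrier_def)
  have eS: "e \<in> rees_carrier n" by (simp add: car e_def permutes_id)
  have clos: "\<And>s x y. s \<in> rees_carrier n \<Longrightarrow> x \<in> X \<Longrightarrow> \<phi> s x = Some y \<Longrightarrow> y \<in> X"
    and mul: "\<And>s t x. s \<in> rees_carrier n \<Longrightarrow> t \<in> rees_carrier n \<Longrightarrow> x \<in> X \<Longrightarrow>
        \<phi> (rees_mult \<sigma> s t) x = Option.bind (\<phi> s x) (\<phi> t)"
    and faith: "\<And>s t. s \<in> rees_carrier n \<Longrightarrow> t \<in> rees_carrier n \<Longrightarrow> (\<And>x. x \<in> X \<Longrightarrow> \<phi> s x = \<phi> t x) \<Longrightarrow> s = t"
    using act unfolding partial_faithful_action_def by blast+
  have Y_act: "\<phi> (1,g,1) y = Some (\<theta> g y) \<and> \<theta> g y \<in> Y" if "g permutes {1..n}" "y \<in> Y" for g y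
  proof -
    have gS: "(1,g,1) \<in> rees_carrier n" "(1,inv g,1) \<in> rees_carrier n"
      using that by (auto simp: car permutes_inv)
    have "rees_mult \<sigma> (1,g,1) (1,inv g,1) = e"
      using permutes_inv_o(2)[OF that(1)] by (simp add: rees_mult_def sandwich_def e_def)
    then have "Option.bind (\<phi> (1,g,1) y) (\<phi> (1,inv g,1)) = Some y"
      using mul[OF gS, of y] that by (auto simp: Y_def)
    then obtain z where z: "\<phi> (1,g,1) y = Some z" by (cases "\<phi> (1,g,1) y") auto
    have "rees_mult \<sigma> (1,g,1) e = (1,g,1)"
      by (simp add: rees_mult_def sandwich_def e_def)
    then have "\<phi> e z = Some z" using mul[OF gS(1) eS, of y] that z by (auto simp: Y_def)
    moreover have "z \<in> X" using clos[OF gS(1) _ z] that by (simp add: Y_def)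
    ultimately show ?thesis using z that by (auto simp: \<theta>_def Y_def)
  qed
  have out: "\<theta> g y = y" if "y \<notin> Y" for g y using that by (simp add: \<theta>_def)
  have comp: "\<theta> (g \<circ> h) = \<theta> g \<circ> \<theta> h" if "g permutes {1..n}" "h permutes {1..n}" for g h
  proof
    fix y
    show "\<theta> (g \<circ> h) y = (\<theta> g \<circ> \<theta> h) y"
    proof (cases "y \<in> Y")
      case True
      have "rees_mult \<sigma> (1,h,1) (1,g,1) = (1,g \<circ> h,1)"
        by (simp add: rees_mult_def sandwich_def)
      moreover have "(1,h,1) \<in> rees_carrier n" "(1,g,1) \<in> rees_carrier n" using that by (auto simp: car)
      ultimately have "\<phi> (1,g \<circ> h,1) y = Option.bind (\<phi> (1,h,1) y) (\<phi> (1,g,1))"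
        using mul[of "(1,h,1)" "(1,g,1)" y] True by (auto simp: Y_def)
      then show ?thesis using Y_act[OF that(2) True] Y_act[OF that(1), of "\<theta> h y"]
          Y_act[OF permutes_compose[OF that(2,1)] True] by simp
    qed (simp add: out)
  qed
  have theta_id: "\<theta> id = id"
    by (rule ext) (auto simp: \<theta>_def Y_def e_def)
  have perm: "\<theta> g permutes Y" if g: "g permutes {1..n}" for g
  proof -
    have "\<theta> g \<circ> \<theta> (inv g) = id" "\<theta> (inv g) \<circ> \<theta> g = id"
      using comp[OF g permutes_inv[OF g]] comp[OF permutes_inv[OF g] g] g
      by (simp_all add: permutes_inv_o theta_id)
    then have "bij (\<theta> g)" by (rule o_bij[rotated])
    then show ?thesis using out by (simp add: permutes_def bij_iff)
  qed
  \<comment> \<open>Since \<open>e\<close> is idempotent, its image consists of its fixed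
    points.\<close>
  have eY: "y \<in> Y" if "x \<in> X" "\<phi> e x = Some y" for x y
  proof -
    have "rees_mult \<sigma> e e = e" by (simp add: rees_mult_def sandwich_def e_def)
    then have "\<phi> e y = Some y" using mul[OF eS eS that(1)] that by simp
    then show ?thesis using clos[OF eS that] by (simp add: Y_def)
  qed
  have faithful: "g = id" if g: "g permutes {1..n}" and "\<theta> g = id" for g
  proof -
    have gS: "(1,g,1) \<in> rees_carrier n" using g by (auto simp: car)
    \<comment> \<open>As \<open>(1,g,1)\<close> absorbs \<open>e\<close> on the left, its action on
      all of \<open>X\<close> is determined by its action on \<open>Y\<close>.\<close>
    have "\<phi> (1,g,1) x = \<phi> e x" if "x \<in> X" for x
    proof -
      have "rees_mult \<sigma> e (1,g,1) = (1,g,1)" by (simp add: rees_mult_def sandwich_def e_def)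
      then have *: "\<phi> (1,g,1) x = Option.bind (\<phi> e x) (\<phi> (1,g,1))" using mul[OF eS gS that] by simp
      show ?thesis
      proof (cases "\<phi> e x")
        case None then show ?thesis using * by simp
      next
        case (Some y)
        then have "\<phi> (1,g,1) y = Some y" using Y_act[OF g eY[OF \<open>x \<in> X\<close> Some]] \<open>\<theta> g = id\<close> by simp
        then show ?thesis using * Some by simp
      qed
    qed
    then have "(1,g,1) = e" using faith[OF gS eS] by blast
    then show ?thesis by (simp add: e_def)
  qed
  have fY: "finite Y" using assms(1) by (simp add: Y_def)
  interpret faithful_sym_action n Y \<theta>
    using fY perm comp faithful by unfold_locales
  \<comment> \<open>\<open>\<iota>\<close> changes the last index from 1 to 2. Applying
    \<open>e\<close> afterwards undoes it, since the entry for \<open>b = 2\<close>,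
    \<open>a = 1\<close> is \<open>id\<close>; hence it is injective.\<close>
  define \<iota> where "\<iota> y = the (\<phi> (1,id,2) y)" for y
  have iS: "(1,id,2) \<in> rees_carrier n" "(2,id,1) \<in> rees_carrier n"
    by (auto simp: car permutes_id)
  have iota: "\<phi> (1,id,2) y = Some (\<iota> y)" "\<iota> y \<in> X" "\<phi> e (\<iota> y) = Some y" if "y \<in> Y" for y
  proof -
    have "rees_mult \<sigma> (1,id,2) e = e" by (simp add: rees_mult_def sandwich_def e_def)
    then have *: "Option.bind (\<phi> (1,id,2) y) (\<phi> e) = Some y"
      using mul[OF iS(1) eS, of y] that by (auto simp: Y_def)
    then show "\<phi> (1,id,2) y = Some (\<iota> y)" by (cases "\<phi> (1,id,2) y") (auto simp: \<iota>_def)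
    then show "\<iota> y \<in> X" "\<phi> e (\<iota> y) = Some y"
      using clos[OF iS(1), of y "\<iota> y"] that * by (auto simp: Y_def)
  qed
  \<comment> \<open>If \<open>\<iota> y\<close> lies in \<open>Y\<close>, then \<open>e\<close>
    fixes it and so \<open>\<iota> y = y\<close>. Now \<open>(2,id,1)\<close> acts on this one point
    both after \<open>b = 2\<close> (entry \<open>\<sigma>\<close>) and after \<open>b = 1\<close>
    (entry \<open>id\<close>), so \<open>\<sigma>\<close> must fix \<open>y\<close>.\<close>
  have fixed: "\<theta> \<sigma> y = y" if y: "y \<in> Y" and "\<iota> y \<in> Y" for y
  proof -
    have yX: "y \<in> X" "\<phi> e y = Some y" using y by (auto simp: Y_def)
    have "\<iota> y = y" using iota(3)[OF y] \<open>\<iota> y \<in> Y\<close> by (simp add: Y_def)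
    moreover have "rees_mult \<sigma> (1,id,2) (2,id,1) = (1,\<sigma>,1)"
      by (simp add: rees_mult_def sandwich_def)
    ultimately have "\<phi> (1,\<sigma>,1) y = \<phi> (2,id,1) y"
      using mul[OF iS yX(1)] iota(1)[OF y] by simp
    moreover have "rees_mult \<sigma> e (2,id,1) = e"
      by (simp add: rees_mult_def sandwich_def e_def)
    then have "\<phi> (2,id,1) y = Some y"
      using mul[OF eS iS(2) yX(1)] yX by simp
    ultimately show ?thesis using Y_act[OF \<sigma> y] by simp
  qed
  have M: "supp (\<theta> \<sigma>) \<subseteq> Y" using supp_subset[OF \<sigma>] .
  have "inj_on \<iota> Y" using iota(3) by (metis inj_onI option.inject)
  then have "card (\<iota> ` supp (\<theta> \<sigma>)) = card (supp (\<theta> \<sigma>))"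
    using M card_image inj_on_subset by blast
  moreover have "Y \<inter> \<iota> ` supp (\<theta> \<sigma>) = {}"
    using fixed M by (auto simp: supp_def)
  moreover have "Y \<union> \<iota> ` supp (\<theta> \<sigma>) \<subseteq> X"
    using M iota(2) by (auto simp: Y_def)
  moreover have "finite (\<iota> ` supp (\<theta> \<sigma>))" using finite_supp[OF \<sigma>] by simp
  ultimately have "card Y + card (supp (\<theta> \<sigma>)) \<le> card X"
    using card_Un_disjoint[OF fY] card_mono[OF assms(1)] by metis
  then show thesis using that faithful_sym_action_axioms by blast
qed

text \<open>The pair \<open>(y, False)\<close> is \<open>y\<close> in the first copy of
  \<open>Y\<close> and \<open>(y, True)\<close> is its twin in the second. Only moved points get a
  twin: for a point fixed by \<open>\<theta> \<sigma>\<close> the entries \<open>id\<close> and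
  \<open>\<sigma>\<close> have the same effect.\<close>

lemma (in faithful_sym_action) total_action_exists:
  assumes \<sigma>: "\<sigma> permutes {1..n}" "\<sigma> \<noteq> id"
  obtains X \<phi> where "finite X" "card X = card Y + card (supp (\<theta> \<sigma>))"
    "total_faithful_action (rees_carrier n) (rees_mult \<sigma>) X \<phi>"
proof -
  define Z where "Z = Y \<times> {False} \<union> supp (\<theta> \<sigma>) \<times> {True}"
  \<comment> \<open>An incoming twin meets the entry \<open>\<sigma>\<close> exactly when
    \<open>a = 2\<close>. The result goes to the copy named by \<open>b\<close>, except that fixed
    points stay in the shared copy.\<close>
  define F where "F s z = (case s of (a,g,b) \<Rightarrow> case z of (y,u) \<Rightarrow>
      let w = \<theta> g (if u \<and> a = (2::nat) then \<theta> \<sigma> y else y) in (w, b = (2::nat) \<and> \<theta> \<sigma> w \<noteq> w))" for s z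
  have car: "(a,g,b) \<in> rees_carrier n \<longleftrightarrow> a \<in> {1,2} \<and> g permutes {1..n} \<and> b \<in> {1,2}" for a g b
    by (auto simp: rees_carrier_def)
  have inY: "\<theta> g y \<in> Y \<longleftrightarrow> y \<in> Y" if "g permutes {1..n}" for g y
    using permutes_in_image permutes_Y that by metis
  have MY: "y \<in> Y" if "\<theta> \<sigma> y \<noteq> y" for y using supp_subset[OF \<sigma>(1)] that by (auto simp: supp_def)
  have F_in: "F s z \<in> Z" if "s \<in> rees_carrier n" "z \<in> Z" for s z
    using that MY by (cases s; cases z) (auto simp: F_def Z_def car Let_def supp_def inY inY[OF \<sigma>(1)])
  have F_mult: "F (rees_mult \<sigma> s t) z = F t (F s z)"
    if s: "s \<in> rees_carrier n" and t: "t \<in> rees_carrier n" for s t z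
  proof -
    obtain a g b where s': "s = (a,g,b)" by (cases s) auto
    obtain a' g' b' where t': "t = (a',g',b')" by (cases t) auto
    obtain y u where z': "z = (y,u)" by (cases z) auto
    have p: "g permutes {1..n}" "g' permutes {1..n}" using s t by (auto simp: s' t' car)
    have "\<theta> (g' \<circ> sandwich \<sigma> b a' \<circ> g) = \<theta> g' \<circ> \<theta> (sandwich \<sigma> b a') \<circ> \<theta> g"
      using p \<sigma> by (auto simp: comp permutes_compose sandwich_def)
    then show ?thesis
      by (auto simp: s' t' z' F_def rees_mult_def Let_def sandwich_def)
  qed
  \<comment> \<open>One moved point separates the outer indices: the preimage of \<open>y0\<close>
    under \<open>\<theta> g\<close> reveals \<open>b\<close> through the tag, and the twin of
    \<open>y0\<close> reveals \<open>a\<close>.\<close>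
  obtain y0 where y0: "\<theta> \<sigma> y0 \<noteq> y0" using faithful[OF \<sigma>(1)] \<sigma>(2) by (metis eq_id_iff)
  have F_faithful: "s = t"
    if s: "s \<in> rees_carrier n" and t: "t \<in> rees_carrier n" and eq: "\<And>z. z \<in> Z \<Longrightarrow> F s z = F t z" for s t
  proof -
    obtain a g b where s': "s = (a,g,b)" by (cases s) auto
    obtain a' g' b' where t': "t = (a',g',b')" by (cases t) auto
    have p: "g permutes {1..n}" "g' permutes {1..n}" and ab: "a \<in> {1,2}" "b \<in> {1,2}" "a' \<in> {1,2}" "b' \<in> {1,2}"
      using s t by (auto simp: s' t' car)
    have pY: "\<theta> g permutes Y" "\<theta> g' permutes Y" using p permutes_Y by auto
    have "\<theta> g y = \<theta> g' y" for y
    proof (cases "y \<in> Y")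
      case True then show ?thesis using eq[of "(y,False)"] by (auto simp: Z_def F_def s' t' Let_def)
    qed (metis pY permutes_not_in)
    then have g: "g = g'" using eqD p by blast
    obtain y1 where y1: "\<theta> g y1 = y0" using pY(1) by (metis permutes_surj surjD)
    have "y1 \<in> Y" using y1 MY[OF y0] inY p by blast
    then have "(b = 2) = (b' = 2)"
      using eq[of "(y1,False)"] y0 by (auto simp: Z_def F_def s' t' Let_def g[symmetric] y1)
    then have b: "b = b'" using ab by auto
    have "(y0,True) \<in> Z" using y0 by (simp add: Z_def supp_def)
    then have "\<theta> g (if a = 2 then \<theta> \<sigma> y0 else y0) = \<theta> g (if a' = 2 then \<theta> \<sigma> y0 else y0)"
      using eq[of "(y0,True)"] unfolding F_def s' t' Let_def g[symmetric] by simp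
    then have "(if a = 2 then \<theta> \<sigma> y0 else y0) = (if a' = 2 then \<theta> \<sigma> y0 else y0)"
      using injD[OF permutes_inj[OF pY(1)]] by blast
    then have "(a = 2) = (a' = 2)" using y0 by (cases "a = 2"; cases "a' = 2") simp_all
    then have "a = a'" using ab by auto
    then show ?thesis using s' t' g b by simp
  qed
  have fZ: "finite Z" using finite_Y finite_supp[OF \<sigma>(1)] by (simp add: Z_def)
  have cZ: "card Z = card Y + card (supp (\<theta> \<sigma>))"
    unfolding Z_def using finite_Y finite_supp[OF \<sigma>(1)]
    by (subst card_Un_disjoint) (auto simp: card_cartesian_product)
  \<comment> \<open>The action is transported to an initial segment of the naturals, since degrees
    are defined through sets of naturals.\<close>
  obtain h where h: "bij_betw h Z {0..<card Z}" using ex_bij_betw_finite_nat[OF fZ] by blast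
  define k where "k = inv_into Z h"
  have kh: "k (h z) = z" if "z \<in> Z" for z using h that by (simp add: k_def bij_betw_inv_into_left)
  have k: "k x \<in> Z" "h (k x) = x" if "x \<in> {0..<card Z}" for x
    using h that by (auto simp: k_def bij_betw_inv_into_right bij_betw_def inv_into_into)
  have hZ: "h z \<in> {0..<card Z}" if "z \<in> Z" for z using h that by (meson bij_betwE)
  have "total_faithful_action (rees_carrier n) (rees_mult \<sigma>) {0..<card Z} (\<lambda>s x. h (F s (k x)))"
    unfolding total_faithful_action_def
  proof (intro conjI ballI impI)
    fix s x assume "s \<in> rees_carrier n" "x \<in> {0..<card Z}"
    then show "h (F s (k x)) \<in> {0..<card Z}" using hZ F_in k by blast
  next
    fix s t x assume "s \<in> rees_carrier n" "t \<in> rees_carrier n" "x \<in> {0..<card Z}"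
    then show "h (F (rees_mult \<sigma> s t) (k x)) = h (F t (k (h (F s (k x)))))"
      using F_mult F_in k kh by simp
  next
    fix s t assume st: "s \<in> rees_carrier n" "t \<in> rees_carrier n" "s \<noteq> t"
    then obtain z where "z \<in> Z" "F s z \<noteq> F t z" using F_faithful by blast
    then have "h (F s (k (h z))) \<noteq> h (F t (k (h z)))" using kh F_in st by metis
    then show "\<exists>x\<in>{0..<card Z}. h (F s (k x)) \<noteq> h (F t (k x))" using hZ \<open>z \<in> Z\<close> by blast
  qed
  then show thesis using that[of "{0..<card Z}"] cZ by simp
qed

lemma partial_faithful_action_of_total:
  assumes "total_faithful_action S mul X \<phi>"
  shows "partial_faithful_action S mul X (\<lambda>s x. Some (\<phi> s x))"
  using assms by (auto simp: total_faithful_action_def partial_faithful_action_def)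

text \<open>A total action is a partial one, so the lower bound for partial actions and the
  construction of a total action settle both degrees at once. The witness \<open>Y\<close> may have
  any type, while the bound concerns the sets of naturals that partial actions produce.\<close>

lemma min_degrees_eqI:
  assumes \<sigma>: "\<sigma> permutes {1..n}" "\<sigma> \<noteq> id"
    and ex: "faithful_sym_action n Y \<theta>" "card Y + card (supp (\<theta> \<sigma>)) = d"
    and lower: "\<And>Y \<theta>. faithful_sym_action n (Y::nat set) \<theta> \<Longrightarrow> d \<le> card Y + card (supp (\<theta> \<sigma>))"
  shows "min_partial_degree (rees_carrier n) (rees_mult \<sigma>) = d"
    and "min_total_degree (rees_carrier n) (rees_mult \<sigma>) = d"
proof -
  interpret faithful_sym_action n Y \<theta> by (rule ex)
  obtain X \<phi> where X: "finite X" "card X = d" "total_faithful_action (rees_carrier n) (rees_mult \<sigma>) X \<phi>"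
    using total_action_exists[OF \<sigma>] ex(2) by metis
  have part: "d \<le> card X"
    if "finite X" "partial_faithful_action (rees_carrier n) (rees_mult \<sigma>) X \<phi>" for X \<phi>
    by (rule faithful_sym_action_of_partial[OF that \<sigma>(1)])
      (use lower le_trans in blast)
  show "min_partial_degree (rees_carrier n) (rees_mult \<sigma>) = d"
    unfolding min_partial_degree_def
  proof (rule Least_equality)
    show "\<exists>X \<phi>. finite X \<and> card X = d \<and> partial_faithful_action (rees_carrier n) (rees_mult \<sigma>) X \<phi>"
      using X(1,2) partial_faithful_action_of_total[OF X(3)] by blast
    fix m
    assume "\<exists>X \<phi>. finite X \<and> card X = m \<and> partial_faithful_action (rees_carrier n) (rees_mult \<sigma>) X \<phi>"
    then show "d \<le> m" using part by blast
  qed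
  show "min_total_degree (rees_carrier n) (rees_mult \<sigma>) = d"
    unfolding min_total_degree_def
  proof (rule Least_equality)
    show "\<exists>X \<phi>. finite X \<and> card X = d \<and> total_faithful_action (rees_carrier n) (rees_mult \<sigma>) X \<phi>"
      using X by blast
    fix m
    assume "\<exists>X \<phi>. finite X \<and> card X = m \<and> total_faithful_action (rees_carrier n) (rees_mult \<sigma>) X \<phi>"
    then obtain X \<phi> where "finite X" "card X = m"
      "total_faithful_action (rees_carrier n) (rees_mult \<sigma>) X \<phi>" by blast
    then show "d \<le> m" using part[OF _ partial_faithful_action_of_total] by blast
  qed
qed

section \<open>Permutations moving few points\<close>

lemma even_card_fixpoint_free_involution:
  assumes "finite A" and "\<And>x. x \<in> A \<Longrightarrow> h x \<in> A \<and> h (h x) = x \<and> h x \<noteq> x"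
  shows "even (card A)"
  using assms
proof (induction A rule: finite_psubset_induct)
  case (psubset A)
  show ?case
  proof (cases "A = {}")
    case False
    then obtain x where x: "x \<in> A" by blast
    note hx = psubset.prems[OF x]
    have "even (card (A - {x, h x}))"
    proof (rule psubset.IH)
      fix y assume y: "y \<in> A - {x, h x}"
      then have "h y \<noteq> x" "h y \<noteq> h x" using psubset.prems[of y] hx by auto
      then show "h y \<in> A - {x, h x} \<and> h (h y) = y \<and> h y \<noteq> y" using psubset.prems[of y] y by auto
    qed (use x in auto)
    moreover have "card (A - {x, h x}) = card A - 2"
      using x hx by (subst card_Diff_subset) auto
    moreover have "card A \<ge> 2"
      using card_mono[OF psubset.hyps(1), of "{x, h x}"] x hx by auto
    ultimately show ?thesis by simp
  qed simp
qed

lemma funpow_eq_diff: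
  assumes "inj f" "i \<le> j" "(f ^^ i) x = (f ^^ j) x"
  shows "(f ^^ (j - i)) x = x"
proof -
  have "(f ^^ i) ((f ^^ (j - i)) x) = (f ^^ i) x"
    using assms by (metis comp_apply funpow_add le_add_diff_inverse)
  then show ?thesis using inj_fn[OF assms(1)] by (meson injD)
qed

lemma funpow_permutes: "f permutes A \<Longrightarrow> f ^^ k permutes A"
  by (induction k) (auto intro: permutes_compose)

text \<open>The points moved by \<open>f ^^ 2\<close> are paired off by \<open>f ^^ 2\<close>, the
  other moved points by \<open>f\<close> itself.\<close>

lemma even_card_supp:
  assumes "inj f" "finite (supp f)" "f ^^ 4 = id"
  shows "even (card (supp f))"
proof -
  let ?F = "supp f \<inter> supp (f ^^ 2)" and ?E = "supp f - supp (f ^^ 2)"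
  have f4: "f (f (f (f x))) = x" for x
    using fun_cong[OF assms(3), of x] by (simp add: eval_nat_numeral)
  have eq: "f x = f y \<longleftrightarrow> x = y" for x y using assms(1) by (auto simp: inj_eq)
  have "even (card ?F)"
  proof (rule even_card_fixpoint_free_involution[of _ "f ^^ 2"])
    show "finite ?F" using assms(2) by simp
  qed (auto simp: supp_def eval_nat_numeral eq f4)
  moreover have "even (card ?E)"
  proof (rule even_card_fixpoint_free_involution[of _ f])
    show "finite ?E" using assms(2) by simp
  qed (auto simp: supp_def eval_nat_numeral eq f4)
  moreover have "card (supp f) = card ?F + card ?E"
    using card_Int_Diff[OF assms(2)] by blast
  ultimately show ?thesis by simp
qed

lemma card_supp_neq_1:
  assumes "inj f"
  shows "card (supp f) \<noteq> 1"
proof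
  assume "card (supp f) = 1"
  then obtain a where a: "supp f = {a}" by (auto simp: card_1_singleton_iff)
  then have "f a \<in> {a}" using image_in_supp[OF assms, of a] by auto
  then show False using a in_supp_iff[of a f] by simp
qed

lemma card_supp_2_power:
  assumes "inj f" "card (supp f) = 2"
  shows "f ^^ 2 = id"
proof -
  obtain a b where ab: "supp f = {a,b}" "a \<noteq> b" using assms(2) by (auto simp: card_2_iff)
  have "f x \<in> {a,b}" "f x \<noteq> x" if "x \<in> {a,b}" for x
    using image_in_supp[OF assms(1), of x] in_supp_iff[of x f] ab that by auto
  from this[of a] this[of b] ab have "f a = b" "f b = a" by auto
  moreover have "f x = x" if "x \<notin> {a,b}" for x using that ab in_supp_iff[of x f] by auto
  ultimately show ?thesis by (auto simp: fun_eq_iff eval_nat_numeral) metis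
qed

lemma card_supp_3_power:
  assumes "inj f" "card (supp f) = 3"
  shows "f ^^ 3 = id"
proof -
  obtain a b c where ab: "supp f = {a,b,c}" "a \<noteq> b" "a \<noteq> c" "b \<noteq> c"
    using assms(2) by (auto simp: card_3_iff)
  have *: "f x \<in> {a,b,c}" "f x \<noteq> x" if "x \<in> {a,b,c}" for x
    using image_in_supp[OF assms(1), of x] in_supp_iff[of x f] ab that by auto
  have eq: "f x = f y \<longleftrightarrow> x = y" for x y using assms(1) by (auto simp: inj_eq)
  have "f (f (f x)) = x" if "x \<in> {a,b,c}" for x
    using *[of a] *[of b] *[of c] eq[of a b] eq[of a c] eq[of b c] ab that
    by (elim insertE emptyE) (auto split: if_splits)
  moreover have "f x = x" if "x \<notin> {a,b,c}" for x using that ab in_supp_iff[of x f] by auto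
  ultimately show ?thesis by (auto simp: fun_eq_iff eval_nat_numeral) metis
qed

text \<open>Four moved points form either two 2-cycles or one 4-cycle, and a 4-cycle is odd.\<close>

lemma card_supp_4_cases:
  assumes "bij f" "card (supp f) = 4"
  shows "f ^^ 2 = id \<or> f ^^ 4 = id \<and> sign f = -1"
proof (cases "f ^^ 2 = id")
  case False
  have eq: "f x = f y \<longleftrightarrow> x = y" for x y using assms(1) by (auto simp: bij_def inj_eq)
  have inj: "inj f" using assms(1) by (simp add: bij_is_inj)
  obtain a where a: "f (f a) \<noteq> a" using False by (auto simp: fun_eq_iff eval_nat_numeral)
  define b where "b = f a"
  define c where "c = f b"
  define d where "d = f c"
  have fin: "finite (supp f)" using assms(2) by (intro card_ge_0_finite) simp
  have "a \<in> supp f" using a by (auto simp: supp_def)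
  then have sup: "a \<in> supp f" "b \<in> supp f" "c \<in> supp f" "d \<in> supp f"
    by (simp_all add: b_def c_def d_def image_in_supp[OF inj])
  have ne: "a \<noteq> b" "b \<noteq> c" "c \<noteq> d" "a \<noteq> c" "b \<noteq> d"
    using sup a by (auto simp: supp_def b_def c_def d_def eq)
  have "d \<noteq> a"
  proof
    \<comment> \<open>A 3-cycle would leave a single further moved point with no possible
      image.\<close>
    assume da: "d = a"
    have "card {a,b,c} = 3" using ne by auto
    then have "card (supp f - {a,b,c}) = 1"
      using sup assms(2) by (subst card_Diff_subset) auto
    then obtain e where e: "supp f - {a,b,c} = {e}" by (auto simp: card_1_singleton_iff)
    then have "f e \<in> supp f" using image_in_supp[OF inj, of e] by blast
    moreover have "f e \<noteq> a" "f e \<noteq> b" "f e \<noteq> c" using e eq da by (auto simp: b_def c_def d_def)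
    moreover have "f e \<noteq> e" using e by (auto simp: supp_def)
    ultimately show False using e by auto
  qed
  then have "card {a,b,c,d} = 4" using ne by auto
  then have S: "supp f = {a,b,c,d}"
    using card_subset_eq[OF fin, of "{a,b,c,d}"] sup assms(2) by auto
  have "f d \<in> supp f" using image_in_supp[OF inj] sup by blast
  moreover have "f d \<noteq> b" "f d \<noteq> c" "f d \<noteq> d" using ne \<open>d \<noteq> a\<close> eq sup in_supp_iff[of d f] by (auto simp: b_def c_def d_def)
  ultimately have fd: "f d = a" using S by auto
  have out: "f x = x" if "x \<notin> {a,b,c,d}" for x using that S in_supp_iff[of x f] by auto
  have "f = transpose a b \<circ> transpose b c \<circ> transpose c d"
    using ne \<open>d \<noteq> a\<close> fd out
    by (auto simp: fun_eq_iff transpose_def b_def[symmetric] c_def[symmetric] d_def[symmetric])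
  then have "sign f = -1"
    using ne by (simp add: sign_compose sign_swap_id permutation_compose permutation_swap_id)
  moreover have "f (f (f (f x))) = x" for x
    using out[of x] by (cases "x \<in> {a,b,c,d}") (auto simp: b_def[symmetric] c_def[symmetric] d_def[symmetric] fd)
  ultimately show ?thesis by (auto simp: fun_eq_iff eval_nat_numeral)
qed simp

lemma card_supp_4_power:
  assumes "bij f" "card (supp f) = 4"
  shows "f ^^ 4 = id"
proof -
  have "f ^^ 4 = f ^^ 2 \<circ> f ^^ 2" by (simp flip: funpow_add)
  then show ?thesis using card_supp_4_cases[OF assms] by auto
qed

text \<open>Strips off known cycles, so that the facts about small supports apply to what
  remains.\<close>

lemma remove_invariant_subset:
  assumes "bij f" "f ` C = C"
  obtains g where "bij g" "supp g = supp f - C" "\<And>k y. y \<notin> C \<Longrightarrow> (g ^^ k) y = (f ^^ k) y"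
proof -
  define g where "g y = (if y \<in> C then y else f y)" for y
  have eq: "f x = f y \<longleftrightarrow> x = y" for x y using assms(1) by (auto simp: bij_def inj_eq)
  have fC: "f x \<in> C \<longleftrightarrow> x \<in> C" for x
    using assms inj_image_mem_iff[OF bij_is_inj] by metis
  have "inj g"
  proof (rule injI)
    fix x y assume "g x = g y"
    then show "x = y" using fC[of x] fC[of y] eq[of x y] by (auto simp: g_def split: if_splits)
  qed
  moreover have "surj g"
    unfolding surj_def
  proof
    fix y
    obtain x where x: "y = f x" using assms(1) by (meson bij_pointE)
    show "\<exists>x. y = g x"
      using fC[of x] x by (cases "y \<in> C") (auto simp: g_def intro: exI[of _ y] exI[of _ x])
  qed
  moreover have "supp g = supp f - C" by (auto simp: supp_def g_def)
  moreover have "(g ^^ k) y = (f ^^ k) y \<and> (f ^^ k) y \<notin> C" if "y \<notin> C" for k y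
    by (induction k) (auto simp: g_def fC that)
  ultimately show thesis using that[of g] by (simp add: bij_def)
qed

text \<open>A shorter cycle through \<open>x\<close> leaves too few points. After a 2-cycle four
  remain and after a 4-cycle two remain, so \<open>f ^^ 4 = id\<close>; after a 3-cycle three
  remain, so \<open>f ^^ 3 = id\<close>; after a 5-cycle one moved point would be left
  alone.\<close>

lemma all_cycles_of_length_6I:
  assumes f: "f permutes {1..6}" and "supp f = {1..6}" "f ^^ 3 \<noteq> id" "f ^^ 4 \<noteq> id"
  shows "all_cycles_of_length 6 f 6"
  unfolding all_cycles_of_length_def
proof (intro ballI conjI allI impI)
  fix x :: nat assume x: "x \<in> {1..6}"
  have bij: "bij f" and inj: "inj f" using f by (auto simp: permutes_bij permutes_inj)
  have eq: "f u = f v \<longleftrightarrow> u = v" for u v using inj by (auto simp: inj_eq)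
  have fin: "f ` C = C" if "f ` C \<subseteq> C" "finite C" for C
    using endo_inj_surj[OF that(2,1) inj_on_subset[OF inj]] by simp
  have ins: "(f ^^ k) x \<in> {1..6}" for k
    using x permutes_in_image[OF funpow_permutes[OF f, of k], of x] by blast
  have f1: "f x \<noteq> x" using x assms(2) in_supp_iff[of x f] by blast
  have f2: "(f ^^ 2) x \<noteq> x"
  proof
    assume c: "(f ^^ 2) x = x"
    obtain g where g: "bij g" "supp g = supp f - {x, f x}"
      "\<And>k y. y \<notin> {x, f x} \<Longrightarrow> (g ^^ k) y = (f ^^ k) y"
      by (rule remove_invariant_subset[OF bij fin, of "{x, f x}"]) (use c in \<open>auto simp: eval_nat_numeral\<close>)
    have "card (supp g) = 4"
      unfolding g(2) assms(2) using f1 x ins[of 1] by (subst card_Diff_subset) auto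
    then have g4: "g ^^ 4 = id" using card_supp_4_power g(1) by blast
    have "(f ^^ 4) y = y" for y
    proof (cases "y \<in> {x, f x}")
      case True then show ?thesis using c by (auto simp: eval_nat_numeral)
    next
      case False then show ?thesis using g(3)[of y 4] g4 by simp
    qed
    then show False using assms(4) by auto
  qed
  have f3: "(f ^^ 3) x \<noteq> x"
  proof
    assume c: "(f ^^ 3) x = x"
    let ?C = "{x, f x, f (f x)}"
    obtain g where g: "bij g" "supp g = supp f - ?C" "\<And>k y. y \<notin> ?C \<Longrightarrow> (g ^^ k) y = (f ^^ k) y"
      by (rule remove_invariant_subset[OF bij fin, of ?C]) (use c in \<open>auto simp: eval_nat_numeral\<close>)
    have "card ?C = 3" using f1 f2 eq by (auto simp: eval_nat_numeral)
    then have "card (supp g) = 3"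
      unfolding g(2) assms(2) using x ins[of 1] ins[of 2] by (subst card_Diff_subset) (auto simp: eval_nat_numeral)
    then have g4: "g ^^ 3 = id" using card_supp_3_power g(1) bij_is_inj by blast
    have "(f ^^ 3) y = y" for y
    proof (cases "y \<in> ?C")
      case True then show ?thesis using c by (auto simp: eval_nat_numeral)
    next
      case False then show ?thesis using g(3)[of y 3] g4 by simp
    qed
    then show False using assms(3) by auto
  qed
  have f4: "(f ^^ 4) x \<noteq> x"
  proof
    assume c: "(f ^^ 4) x = x"
    let ?C = "{x, f x, f (f x), f (f (f x))}"
    obtain g where g: "bij g" "supp g = supp f - ?C" "\<And>k y. y \<notin> ?C \<Longrightarrow> (g ^^ k) y = (f ^^ k) y"
      by (rule remove_invariant_subset[OF bij fin, of ?C]) (use c in \<open>auto simp: eval_nat_numeral\<close>)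
    have "card ?C = 4" using f1 f2 f3 eq by (auto simp: eval_nat_numeral)
    then have "card (supp g) = 2"
      unfolding g(2) assms(2) using x ins[of 1] ins[of 2] ins[of 3]
      by (subst card_Diff_subset) (auto simp: eval_nat_numeral)
    then have g2: "g ^^ 2 = id" using card_supp_2_power g(1) bij_is_inj by blast
    have g4: "g ^^ 4 = g ^^ 2 \<circ> g ^^ 2" by (simp flip: funpow_add)
    have "(f ^^ 4) y = y" for y
    proof (cases "y \<in> ?C")
      case True then show ?thesis using c by (auto simp: eval_nat_numeral)
    next
      case False then show ?thesis using g(3)[of y 4] g4 g2 by simp
    qed
    then show False using assms(4) by auto
  qed
  have f5: "(f ^^ 5) x \<noteq> x"
  proof
    assume c: "(f ^^ 5) x = x"
    let ?C = "{x, f x, f (f x), f (f (f x)), f (f (f (f x)))}"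
    obtain g where g: "bij g" "supp g = supp f - ?C" "\<And>k y. y \<notin> ?C \<Longrightarrow> (g ^^ k) y = (f ^^ k) y"
      by (rule remove_invariant_subset[OF bij fin, of ?C]) (use c in \<open>auto simp: eval_nat_numeral\<close>)
    have "card ?C = 5" using f1 f2 f3 f4 eq by (auto simp: eval_nat_numeral)
    then have "card (supp g) = 1"
      unfolding g(2) assms(2) using x ins[of 1] ins[of 2] ins[of 3] ins[of 4]
      by (subst card_Diff_subset) (auto simp: eval_nat_numeral)
    then show False using card_supp_neq_1 g(1) bij_is_inj by blast
  qed
  show lt: "(f ^^ j) x \<noteq> x" if "0 < j \<and> j < 6" for j
  proof -
    have "j = 1 \<or> j = 2 \<or> j = 3 \<or> j = 4 \<or> j = 5" using that by linarith
    then show ?thesis using f1 f2 f3 f4 f5 by auto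
  qed
  \<comment> \<open>The first six iterates are distinct and fill \<open>{1..6}\<close>, so the next
    one repeats an earlier iterate, which can only be \<open>x\<close> itself.\<close>
  have "inj_on (\<lambda>i. (f ^^ i) x) {..<6}"
  proof (rule linorder_inj_onI)
    fix i j :: nat assume ij: "i < j" "i \<in> {..<6}" "j \<in> {..<6}"
    show "(f ^^ i) x \<noteq> (f ^^ j) x"
      using funpow_eq_diff[OF inj, of i j x] lt[of "j - i"] ij by auto
  qed auto
  then have "card ((\<lambda>i. (f ^^ i) x) ` {..<6}) = 6" by (simp add: card_image)
  moreover have "(\<lambda>i. (f ^^ i) x) ` {..<6} \<subseteq> {1..6}" using ins by blast
  ultimately have "(\<lambda>i. (f ^^ i) x) ` {..<6} = {1..6}" by (intro card_subset_eq) auto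
  then have "(f ^^ 6) x \<in> (\<lambda>i. (f ^^ i) x) ` {..<6}" using ins[of 6] by (rule ssubst)
  then obtain i where i: "i < 6" "(f ^^ 6) x = (f ^^ i) x" by blast
  then have "(f ^^ (6 - i)) x = x" using funpow_eq_diff[OF inj, of i 6 x] by simp
  then have "i = 0" using lt[of "6 - i"] i(1) by (cases "i = 0") auto
  then show "(f ^^ 6) x = x" using i by simp
qed

text \<open>The fourth power is excluded by parity. If the cube were trivial, removing one 3-cycle
  would leave two swapped points, whose cycle length does not divide 3.\<close>

lemma card_supp_5_powers:
  assumes "bij f" "card (supp f) = 5"
  shows "f ^^ 2 \<noteq> id" "f ^^ 3 \<noteq> id" "f ^^ 4 \<noteq> id"
proof -
  have inj: "inj f" using assms(1) by (simp add: bij_is_inj)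
  have eq: "f u = f v \<longleftrightarrow> u = v" for u v using inj by (auto simp: inj_eq)
  have fin: "finite (supp f)" using assms(2) by (intro card_ge_0_finite) simp
  show n4: "f ^^ 4 \<noteq> id" using even_card_supp[OF inj fin] assms(2) by auto
  have "f ^^ 4 = f ^^ 2 \<circ> f ^^ 2" by (simp flip: funpow_add)
  then show "f ^^ 2 \<noteq> id" using n4 by auto
  show "f ^^ 3 \<noteq> id"
  proof
    assume f3: "f ^^ 3 = id"
    have p3: "f (f (f x)) = x" for x using fun_cong[OF f3, of x] by (simp add: eval_nat_numeral)
    obtain x where x: "x \<in> supp f" using assms(2) by fastforce
    let ?C = "{x, f x, f (f x)}"
    have inv: "f ` ?C = ?C" using p3 by auto
    obtain g where g: "bij g" "supp g = supp f - ?C" "\<And>k y. y \<notin> ?C \<Longrightarrow> (g ^^ k) y = (f ^^ k) y"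
      by (rule remove_invariant_subset[OF assms(1) inv]) blast
    have f1: "f x \<noteq> x" using x by (simp add: supp_def)
    have "f (f x) \<noteq> x" using p3[of x] f1 by metis
    then have "card ?C = 3" using f1 eq by auto
    moreover have "?C \<subseteq> supp f" using x image_in_supp[OF inj] by auto
    ultimately have c: "card (supp g) = 2"
      unfolding g(2) using assms(2) by (subst card_Diff_subset) auto
    then have g2: "g ^^ 2 = id" using card_supp_2_power g(1) bij_is_inj by blast
    have "supp g \<noteq> {}" using c by auto
    then obtain y where y: "y \<in> supp g" by blast
    then have "f (f y) = y" using g(2) g(3)[of y 2] fun_cong[OF g2, of y] by (simp add: eval_nat_numeral)
    then have "f y = y" using p3[of y] by simp
    then show False using y g(2) in_supp_iff[of y f] by blast
  qed
qed

text \<open>The root is the 4-cycle sending \<open>a\<close> to \<open>c\<close>, \<open>c\<close>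
  to \<open>f a\<close>, \<open>f a\<close> to \<open>f c\<close> and \<open>f c\<close> to
  \<open>a\<close>.\<close>

lemma double_transposition_square:
  assumes f: "f permutes A" and "card (supp f) = 4" "f ^^ 2 = id"
  obtains r where "r permutes A" "f = r \<circ> r"
proof -
  have ff: "f (f x) = x" for x using fun_cong[OF assms(3), of x] by (simp add: eval_nat_numeral)
  have inj: "inj f" using f by (rule permutes_inj)
  have fin: "finite (supp f)" using assms(2) by (intro card_ge_0_finite) simp
  have sA: "supp f \<subseteq> A" using supp_permutes_subset[OF f] .
  obtain a where a: "a \<in> supp f" using assms(2) by fastforce
  have fa: "f a \<in> supp f" "f a \<noteq> a" using a image_in_supp[OF inj] by (auto simp: supp_def)
  have "card {a, f a} < card (supp f)" using assms(2) fa by simp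
  then obtain c where c: "c \<in> supp f" "c \<noteq> a" "c \<noteq> f a"
    using card_mono[of "{a, f a}" "supp f"] by fastforce
  have fc: "f c \<in> supp f" "f c \<noteq> c" using c image_in_supp[OF inj] by (auto simp: supp_def)
  have ne: "f c \<noteq> a" "f c \<noteq> f a" using c ff[of a] ff[of c] by auto
  have "card {a, f a, c, f c} = 4" using fa c fc ne by auto
  then have S: "supp f = {a, f a, c, f c}"
    using card_subset_eq[OF fin, of "{a, f a, c, f c}"] assms(2) a fa c fc by auto
  define r where "r = transpose a c \<circ> transpose c (f a) \<circ> transpose (f a) (f c)"
  have "r permutes A" unfolding r_def
    using sA S by (intro permutes_compose permutes_swap_id) auto
  moreover have "f = r \<circ> r"
  proof
    fix x
    have "f x = x" if "x \<notin> {a, f a, c, f c}" using that S in_supp_iff[of x f] by auto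
    then show "f x = (r \<circ> r) x"
      using fa c fc ne ff by (cases "x \<in> {a, f a, c, f c}") (auto simp: r_def transpose_def)
  qed
  ultimately show thesis using that by blast
qed

text \<open>The permutation \<open>(a b c d)(e h)\<close> is the product of the squares of \<open>(b e c h d)\<close> and
  \<open>(a d h)\<close>; hence every homomorphism to a symmetric group maps it to an even permutation.\<close>

lemma four_two_cycle_product_of_squares:
  assumes f: "f permutes A" and "card (supp f) = 6" "f ^^ 4 = id" "f ^^ 2 \<noteq> id"
  obtains u v where "u permutes A" "v permutes A" "f = (u \<circ> u) \<circ> (v \<circ> v)"
proof -
  have bij: "bij f" and inj: "inj f" using f by (auto simp: permutes_bij permutes_inj)
  have eq: "f x = f y \<longleftrightarrow> x = y" for x y using inj by (auto simp: inj_eq)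
  have f4: "f (f (f (f x))) = x" for x using fun_cong[OF assms(3), of x] by (simp add: eval_nat_numeral)
  have fin: "finite (supp f)" using assms(2) by (intro card_ge_0_finite) simp
  have sA: "supp f \<subseteq> A" using supp_permutes_subset[OF f] .
  obtain a where a: "f (f a) \<noteq> a" using assms(4) by (auto simp: fun_eq_iff eval_nat_numeral)
  define b where "b = f a"
  define c where "c = f b"
  define d where "d = f c"
  have fd: "f d = a" by (simp add: b_def c_def d_def f4)
  have "a \<in> supp f" using a by (auto simp: supp_def)
  then have sup: "a \<in> supp f" "b \<in> supp f" "c \<in> supp f" "d \<in> supp f"
    by (simp_all add: b_def c_def d_def image_in_supp[OF inj])
  have ne: "a \<noteq> b" "b \<noteq> c" "c \<noteq> d" "a \<noteq> c" "b \<noteq> d"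
    using sup a by (auto simp: supp_def b_def c_def d_def eq)
  have "d \<noteq> a" using fd sup by (auto simp: supp_def)
  note ne = ne this
  let ?C = "{a,b,c,d}"
  have inv: "f ` ?C = ?C" using fd by (auto simp: b_def[symmetric] c_def[symmetric] d_def[symmetric])
  obtain g where g: "bij g" "supp g = supp f - ?C" "\<And>k y. y \<notin> ?C \<Longrightarrow> (g ^^ k) y = (f ^^ k) y"
    by (rule remove_invariant_subset[OF bij inv]) blast
  have "card ?C = 4" using ne by auto
  then have c2: "card (supp g) = 2" unfolding g(2) using assms(2) sup by (subst card_Diff_subset) auto
  then have g2: "g ^^ 2 = id" using card_supp_2_power g(1) bij_is_inj by blast
  have "supp g \<noteq> {}" using c2 by auto
  then obtain e where e: "e \<in> supp g" by blast
  define h where "h = f e"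
  have e': "e \<in> supp f" "e \<notin> ?C" using e g(2) by auto
  have fh: "f h = e" using e' g(3)[of e 2] fun_cong[OF g2, of e] by (simp add: h_def eval_nat_numeral)
  have h: "h \<in> supp f" "h \<noteq> e" using e' by (simp_all add: h_def in_supp_iff eq)
  have "h \<notin> ?C" using e' fd eq by (auto simp: h_def b_def c_def d_def)
  note ne = ne e'(2) h(2) this
  have "card {a,b,c,d,e,h} = 6" using ne by auto
  then have S: "supp f = {a,b,c,d,e,h}"
    using card_subset_eq[OF fin, of "{a,b,c,d,e,h}"] assms(2) sup e' h by auto
  define u where "u = transpose b e \<circ> transpose e c \<circ> transpose c h \<circ> transpose h d"
  define v where "v = transpose a d \<circ> transpose d h"
  have "u permutes A" "v permutes A" unfolding u_def v_def
    using sA S by (auto intro!: permutes_compose permutes_swap_id)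
  moreover have "f = (u \<circ> u) \<circ> (v \<circ> v)"
  proof
    fix x
    have u: "u a = a" "u b = e" "u e = c" "u c = h" "u h = d" "u d = b"
      and v: "v a = d" "v d = h" "v h = a" "v b = b" "v c = c" "v e = e"
      using ne by (auto simp: u_def v_def transpose_def)
    have f: "f a = b" "f b = c" "f c = d" "f e = h" by (simp_all add: b_def c_def d_def h_def)
    show "f x = ((u \<circ> u) \<circ> (v \<circ> v)) x"
    proof (cases "x \<in> {a,b,c,d,e,h}")
      case True
      then show ?thesis using u v f fd fh by (elim insertE emptyE) simp_all
    next
      case False
      then have "f x = x" "u x = x" "v x = x"
        using S in_supp_iff[of x f] by (simp_all add: u_def v_def transpose_def)
      then show ?thesis by simp
    qed
  qed
  ultimately show thesis using that by blast
qed

text \<open>The map \<open>r\<close> preserves the support of its square. If that support had two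
  points, the square of \<open>r\<close> would be trivial on them.\<close>

lemma card_supp_square_neq_2:
  assumes "inj r"
  shows "card (supp (r \<circ> r)) \<noteq> 2"
proof
  assume "card (supp (r \<circ> r)) = 2"
  then obtain a b where ab: "supp (r \<circ> r) = {a,b}" "a \<noteq> b" by (auto simp: card_2_iff)
  have ne: "r (r a) \<noteq> a" "r (r b) \<noteq> b"
    using ab in_supp_iff[of a "r \<circ> r"] in_supp_iff[of b "r \<circ> r"] by auto
  then have "r a \<in> {a,b}" "r b \<in> {a,b}"
    using assms unfolding ab(1)[symmetric] by (simp_all add: in_supp_iff inj_eq)
  then show False using ne by auto
qed

section \<open>Moved points bounded below by order and sign\<close>

context faithful_sym_action
begin

lemma bij_theta: "g permutes {1..n} \<Longrightarrow> bij (\<theta> g)"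
  using permutes_Y permutes_bij by blast

lemma inj_theta: "g permutes {1..n} \<Longrightarrow> inj (\<theta> g)"
  using permutes_Y permutes_inj by blast

lemma theta_funpow: "g permutes {1..n} \<Longrightarrow> \<theta> (g ^^ k) = \<theta> g ^^ k"
  by (induction k) (auto simp: comp funpow_permutes)

text \<open>Faithfulness preserves orders, so an order forced by a small support in \<open>Y\<close>
  restricts \<open>g\<close> itself.\<close>

lemma theta_funpow_id_iff:
  assumes "g permutes {1..n}"
  shows "\<theta> g ^^ k = id \<longleftrightarrow> g ^^ k = id"
  using faithful[OF funpow_permutes[OF assms, of k]] theta_funpow[OF assms, of k] by auto

text \<open>The symmetric group embeds into that of \<open>Y\<close>, so the factorials compare;
  \<open>n \<ge> 2\<close> makes the factorial strictly increasing from \<open>n - 1\<close> to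
  \<open>n\<close>.\<close>

lemma card_Y_ge:
  assumes "n \<ge> 2"
  shows "n \<le> card Y"
proof (rule ccontr)
  assume c: "\<not> n \<le> card Y"
  have "card {g. g permutes {1..n}} \<le> card {g. g permutes Y}"
    by (rule card_inj_on_le[of \<theta>])
      (auto intro!: inj_onI eqD permutes_Y simp: finite_permutations finite_Y)
  then have le: "fact n \<le> (fact (card Y) :: nat)"
    using card_permutations[of "{1..n}" n] card_permutations[OF refl finite_Y] by simp
  also have "\<dots> \<le> fact (n - 1)" using c by (intro fact_mono) auto
  also have "\<dots> < fact n" using assms by (intro fact_less_mono) auto
  finally show False by simp
qed

lemma card_supp_ge_2:
  assumes "g permutes {1..n}" "g \<noteq> id"
  shows "2 \<le> card (supp (\<theta> g))"
proof -
  have "supp (\<theta> g) \<noteq> {}" using faithful assms by (auto simp: supp_def fun_eq_iff)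
  then have "card (supp (\<theta> g)) \<noteq> 0" using finite_supp[OF assms(1)] by simp
  moreover have "card (supp (\<theta> g)) \<noteq> 1" using card_supp_neq_1 inj_theta assms(1) by blast
  ultimately show ?thesis by linarith
qed

lemma card_supp_2D: "g permutes {1..n} \<Longrightarrow> card (supp (\<theta> g)) = 2 \<Longrightarrow> g ^^ 2 = id"
  using card_supp_2_power inj_theta theta_funpow_id_iff by blast

lemma card_supp_3D: "g permutes {1..n} \<Longrightarrow> card (supp (\<theta> g)) = 3 \<Longrightarrow> g ^^ 3 = id"
  using card_supp_3_power inj_theta theta_funpow_id_iff by blast

lemma card_supp_4D: "g permutes {1..n} \<Longrightarrow> card (supp (\<theta> g)) = 4 \<Longrightarrow> g ^^ 4 = id"
  using card_supp_4_power bij_theta theta_funpow_id_iff by blast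

lemma card_supp_ge_3:
  assumes "g permutes {1..n}" "g ^^ 2 \<noteq> id"
  shows "3 \<le> card (supp (\<theta> g))"
proof -
  have "g \<noteq> id" using assms(2) by (auto simp: eval_nat_numeral)
  then show ?thesis using card_supp_ge_2[OF assms(1)] card_supp_2D[OF assms(1)] assms(2) by fastforce
qed

lemma card_supp_ge_5:
  assumes "g permutes {1..n}" "g ^^ 2 \<noteq> id" "g ^^ 3 \<noteq> id" "g ^^ 4 \<noteq> id"
  shows "5 \<le> card (supp (\<theta> g))"
proof -
  have "card (supp (\<theta> g)) \<noteq> 3" "card (supp (\<theta> g)) \<noteq> 4"
    using card_supp_3D[OF assms(1)] card_supp_4D[OF assms(1)] assms by auto
  then show ?thesis using card_supp_ge_3[OF assms(1,2)] by linarith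
qed

text \<open>By cases on the number of points moved by \<open>\<sigma>\<close>. Orders decide two,
  three and five points; four points also need square roots. Six points are all of
  \<open>{1..6}\<close>, where \<open>generic\<close> leaves only the type of a 4-cycle times a
  2-cycle.\<close>

lemma card_supp_le_small:
  assumes \<sigma>: "\<sigma> permutes {1..n}" "\<sigma> \<noteq> id" and "n \<le> 6"
    and generic: "n = 6 \<Longrightarrow> supp \<sigma> = {1..6} \<Longrightarrow>
      \<not> all_cycles_of_length 6 \<sigma> 2 \<and> \<not> all_cycles_of_length 6 \<sigma> 3 \<and> \<not> all_cycles_of_length 6 \<sigma> 6"
  shows "card (supp \<sigma>) \<le> card (supp (\<theta> \<sigma>))"
proof -
  let ?m = "card (supp (\<theta> \<sigma>))"
  have bij: "bij \<sigma>" and inj: "inj \<sigma>" using \<sigma>(1) by (auto simp: permutes_bij permutes_inj)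
  have S: "supp \<sigma> \<subseteq> {1..n}" using supp_permutes_subset[OF \<sigma>(1)] .
  then have "card (supp \<sigma>) \<le> 6" using card_mono[OF _ S] assms(3) by simp
  then consider "card (supp \<sigma>) \<le> 2" | "card (supp \<sigma>) = 3" | "card (supp \<sigma>) = 4"
    | "card (supp \<sigma>) = 5" | "card (supp \<sigma>) = 6" by linarith
  then show ?thesis
  proof cases
    case 1 then show ?thesis using card_supp_ge_2[OF \<sigma>] by linarith
  next
    case 2
    have "\<sigma> ^^ 3 = \<sigma> \<circ> \<sigma> ^^ 2" by (simp add: eval_nat_numeral)
    then have "\<sigma> ^^ 2 \<noteq> id" using card_supp_3_power[OF inj 2] \<sigma>(2) by auto
    then show ?thesis using card_supp_ge_3[OF \<sigma>(1)] 2 by simp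
  next
    case 3
    have p4: "\<sigma> ^^ 4 = id" using card_supp_4_power[OF bij 3] .
    have "\<sigma> ^^ 4 = \<sigma> \<circ> \<sigma> ^^ 3" by (simp add: eval_nat_numeral)
    then have "\<sigma> ^^ 3 \<noteq> id" using p4 \<sigma>(2) by auto
    then have "?m \<noteq> 3" using card_supp_3D[OF \<sigma>(1)] by blast
    moreover have "?m \<noteq> 2"
    proof (cases "\<sigma> ^^ 2 = id")
      case True
      \<comment> \<open>The image of a square is a square, and a square never moves exactly two
        points.\<close>
      obtain r where r: "r permutes {1..n}" "\<sigma> = r \<circ> r"
        using double_transposition_square[OF \<sigma>(1) 3 True] by blast
      then show ?thesis using card_supp_square_neq_2[OF inj_theta[OF r(1)]] comp[OF r(1) r(1)] by simp
    next
      case False then show ?thesis using card_supp_2D[OF \<sigma>(1)] by blast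
    qed
    ultimately show ?thesis using card_supp_ge_2[OF \<sigma>] 3 by linarith
  next
    case 4
    show ?thesis using card_supp_ge_5[OF \<sigma>(1) card_supp_5_powers[OF bij 4]] 4 by simp
  next
    case 5
    have n6: "n = 6" using card_mono[OF _ S] assms(3) 5 by simp
    then have S6: "supp \<sigma> = {1..6}" using card_subset_eq[OF _ S] 5 by simp
    note gen = generic[OF n6 S6]
    have ne: "\<sigma> x \<noteq> x" if "x \<in> {1..6}" for x using that S6 in_supp_iff[of x \<sigma>] by blast
    have p2: "\<sigma> ^^ 2 \<noteq> id"
    proof
      assume p: "\<sigma> ^^ 2 = id"
      have "(\<sigma> ^^ j) x \<noteq> x" if "x \<in> {1..6}" "0 < j \<and> j < 2" for x j
      proof -
        have "j = 1" using that(2) by linarith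
        then show ?thesis using ne[OF that(1)] by simp
      qed
      then show False using gen p by (simp add: all_cycles_of_length_def)
    qed
    have p3: "\<sigma> ^^ 3 \<noteq> id"
    proof
      assume p: "\<sigma> ^^ 3 = id"
      have "(\<sigma> ^^ j) x \<noteq> x" if "x \<in> {1..6}" "0 < j \<and> j < 3" for x j
      proof -
        have "\<sigma> (\<sigma> (\<sigma> x)) = x" using fun_cong[OF p, of x] by (simp add: eval_nat_numeral)
        moreover have "j = 1 \<or> j = 2" using that(2) by linarith
        ultimately show ?thesis using ne[OF that(1)] by (auto simp: eval_nat_numeral)
      qed
      then show False using gen p by (simp add: all_cycles_of_length_def)
    qed
    have p4: "\<sigma> ^^ 4 = id" using all_cycles_of_length_6I[OF _ S6 p3] gen \<sigma>(1) n6 by blast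
    obtain u v where uv: "u permutes {1..n}" "v permutes {1..n}" "\<sigma> = (u \<circ> u) \<circ> (v \<circ> v)"
      using four_two_cycle_product_of_squares[OF \<sigma>(1) 5 p4 p2] by blast
    have "\<theta> \<sigma> = (\<theta> u \<circ> \<theta> u) \<circ> (\<theta> v \<circ> \<theta> v)"
      using uv by (simp add: comp permutes_compose)
    moreover have "permutation (\<theta> u)" "permutation (\<theta> v)"
      using permutes_imp_permutation[OF finite_Y permutes_Y] uv by blast+
    ultimately have "sign (\<theta> \<sigma>) = 1"
      by (simp add: sign_compose permutation_compose)
    \<comment> \<open>With four moved points and a nontrivial square,
      \<open>\<theta> \<sigma>\<close> would be an odd 4-cycle, but it is a product of
      squares.\<close>
    then have "?m \<noteq> 4"
      using card_supp_4_cases[OF bij_theta[OF \<sigma>(1)]] p2 theta_funpow_id_iff[OF \<sigma>(1)] by fastforce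
    moreover have "?m \<noteq> 3" using card_supp_3D[OF \<sigma>(1)] p3 by blast
    moreover have "?m \<noteq> 5"
      using card_supp_5_powers(3)[OF bij_theta[OF \<sigma>(1)]] p4 theta_funpow_id_iff[OF \<sigma>(1)] by blast
    ultimately show ?thesis using card_supp_ge_3[OF \<sigma>(1) p2] 5 by linarith
  qed
qed

end

section \<open>Bochert's bound\<close>

definition cyc3 :: "'a \<Rightarrow> 'a \<Rightarrow> 'a \<Rightarrow> 'a \<Rightarrow> 'a" where
  "cyc3 a b c x = (if x = a then b else if x = b then c else if x = c then a else x)"

lemma cyc3_permutes:
  assumes "a \<in> A" "b \<in> A" "c \<in> A" "distinct [a,b,c]"
  shows "cyc3 a b c permutes A"
proof -
  have "cyc3 a b c = transpose a b \<circ> transpose b c"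
    using assms(4) by (auto simp: fun_eq_iff cyc3_def transpose_def)
  then show ?thesis using assms by (simp add: permutes_compose permutes_swap_id)
qed

lemma cyc3_rotate: "distinct [a,b,c] \<Longrightarrow> cyc3 b c a = cyc3 a b c"
  by (auto simp: fun_eq_iff cyc3_def)

lemma cyc3_square: "distinct [a,b,c] \<Longrightarrow> cyc3 a b c \<circ> cyc3 a b c = cyc3 a c b"
  by (auto simp: fun_eq_iff cyc3_def)

lemma cyc3_cube: "distinct [a,b,c] \<Longrightarrow> cyc3 a b c \<circ> (cyc3 a b c \<circ> cyc3 a b c) = id"
  by (auto simp: fun_eq_iff cyc3_def)

lemma cyc3_conj: "inj k \<Longrightarrow> k \<circ> cyc3 a b c = cyc3 (k a) (k b) (k c) \<circ> k"
  by (auto simp: fun_eq_iff cyc3_def inj_eq)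

text \<open>Away from \<open>x\<close> no point is moved by both maps, so \<open>k\<close> fixes
  \<open>h x\<close> and \<open>h\<close> fixes \<open>k x\<close>. Every point other than
  \<open>x\<close>, \<open>h x\<close> and \<open>k x\<close> is brought back.\<close>

lemma commutator_eq_cyc3:
  assumes "bij h" "bij k" "supp h \<inter> supp k = {x}"
  shows "h \<circ> k \<circ> inv h \<circ> inv k = cyc3 x (h x) (k x)"
proof
  fix z
  have hk: "inv h (h u) = u" "h (inv h u) = u" "inv k (k u) = u" "k (inv k u) = u" for u
    using assms(1,2) by (simp_all add: bij_is_inj bij_is_surj surj_f_inv_f)
  have heq: "h u = h v \<longleftrightarrow> u = v" and keq: "k u = k v \<longleftrightarrow> u = v" for u v
    using hk by metis+
  have x: "h x \<noteq> x" "k x \<noteq> x" using assms(3) by (auto simp: supp_def)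
  have either: "h u = u \<or> k u = u" if "u \<noteq> x" for u using assms(3) that by (auto simp: supp_def)
  have khx: "k (h x) = h x" using either[of "h x"] x heq by auto
  have hkx: "h (k x) = k x" using either[of "k x"] x keq by auto
  have hinv: "inv h u = u \<longleftrightarrow> h u = u" and kinv: "inv k u = u \<longleftrightarrow> k u = u" for u
    using hk by metis+
  show "(h \<circ> k \<circ> inv h \<circ> inv k) z = cyc3 x (h x) (k x) z"
  proof -
    consider "z = x" | "z = h x" | "z \<noteq> h x" "z = k x" | "z \<noteq> x" "z \<noteq> h x" "z \<noteq> k x" by blast
    then show ?thesis
    proof cases
      case 1
      have "inv k x \<noteq> x" using x kinv by blast
      then have "h (inv k x) = inv k x" using either[of "inv k x"] hk(4)[of x] by metis
      then have "inv h (inv k x) = inv k x" using hinv by blast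
      then show ?thesis using 1 hk by (simp add: cyc3_def)
    next
      case 2
      then have "inv k z = z" using khx kinv by blast
      then show ?thesis using 2 hk hkx x by (simp add: cyc3_def)
    next
      case 3
      have "inv h x \<noteq> x" using x hinv by blast
      then have "k (inv h x) = inv h x" using either[of "inv h x"] hk(2)[of x] by metis
      then show ?thesis using 3 hk x by (simp add: cyc3_def)
    next
      case 4
      have "(h \<circ> k \<circ> inv h \<circ> inv k) z = z"
      proof (cases "k z = z")
        case True
        then have 1: "inv k z = z" using kinv by blast
        have "inv h z \<noteq> x" using 4 hk by metis
        then have "k (inv h z) = inv h z" using either[of "inv h z"] True hk(2)[of z] by metis
        then show ?thesis using 1 hk by simp
      next
        case False
        then have "h z = z" using either 4 by blast
        have "inv k z \<noteq> x" using 4 hk by metis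
        moreover have "k (inv k z) \<noteq> inv k z" using False hk kinv by metis
        ultimately have "h (inv k z) = inv k z" using either by blast
        then have "inv h (inv k z) = inv k z" using hinv by blast
        then show ?thesis using \<open>h z = z\<close> hk by simp
      qed
      then show ?thesis using 4 by (simp add: cyc3_def)
    qed
  qed
qed

text \<open>Its classes are the blocks spanned by the 3-cycles in \<open>H\<close>. Closure of
  \<open>H\<close> under composition makes it an equivalence relation; symmetry holds because the
  inverse of a 3-cycle is its square.\<close>

definition cyc3_rel :: "('a \<Rightarrow> 'a) set \<Rightarrow> 'a \<Rightarrow> 'a \<Rightarrow> bool" where
  "cyc3_rel H p q \<longleftrightarrow> p = q \<or> (\<exists>r. distinct [p,q,r] \<and> cyc3 p q r \<in> H)"

section \<open>Blocks spanned by 3-cycles\<close>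

context
  fixes H :: "('a \<Rightarrow> 'a) set"
  assumes closed: "\<And>g h. g \<in> H \<Longrightarrow> h \<in> H \<Longrightarrow> g \<circ> h \<in> H"
begin

lemma cyc3_inverse_mem:
  assumes "cyc3 a b c \<in> H" "distinct [a,b,c]"
  shows "cyc3 a c b \<in> H"
  using closed[OF assms(1,1)] cyc3_square[OF assms(2)] by simp

lemma cyc3_rotate_mem:
  assumes "cyc3 a b c \<in> H" "distinct [a,b,c]"
  shows "cyc3 b c a \<in> H"
  using assms cyc3_rotate by metis

text \<open>The inverse used in the conjugation is the square of the 3-cycle, so it lies in
  \<open>H\<close>.\<close>

lemma cyc3_conj_mem:
  assumes "cyc3 a b c \<in> H" and k: "cyc3 p q r \<in> H" "distinct [p,q,r]"
  shows "cyc3 (cyc3 p q r a) (cyc3 p q r b) (cyc3 p q r c) \<in> H"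
proof -
  let ?k = "cyc3 p q r"
  have "inj ?k" using cyc3_permutes[of p UNIV q r] k(2) permutes_inj by blast
  then have "?k \<circ> cyc3 a b c \<circ> (?k \<circ> ?k) = cyc3 (?k a) (?k b) (?k c) \<circ> (?k \<circ> (?k \<circ> ?k))"
    by (simp add: cyc3_conj comp_assoc)
  also have "\<dots> = cyc3 (?k a) (?k b) (?k c)" by (simp add: cyc3_cube[OF k(2)])
  finally show ?thesis using closed assms by metis
qed

text \<open>Conjugating the first 3-cycle by the second gives \<open>cyc3 q s r\<close>, the inverse
  of the desired one.\<close>

lemma cyc3_exchange:
  assumes "cyc3 p q r \<in> H" "cyc3 p q s \<in> H" "distinct [p,q,r,s]"
  shows "cyc3 q r s \<in> H"
proof -
  have "cyc3 q s r \<in> H"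
    using cyc3_conj_mem[OF assms(1,2)] assms(3) by (simp add: cyc3_def[of p q s] split: if_splits)
  then show ?thesis using cyc3_inverse_mem assms(3) by auto
qed

lemma cyc3_exchange':
  assumes "cyc3 p q r \<in> H" "cyc3 p q s \<in> H" "distinct [p,q,r,s]"
  shows "cyc3 p r s \<in> H"
proof -
  have "cyc3 q p r \<in> H" "cyc3 q p s \<in> H"
    using assms cyc3_inverse_mem cyc3_rotate_mem by (metis distinct_length_2_or_more distinct_singleton)+
  then show ?thesis using cyc3_exchange[of q p r s] assms(3) by auto
qed

lemma cyc3_rel_sym: "cyc3_rel H p q \<Longrightarrow> cyc3_rel H q p"
  unfolding cyc3_rel_def
  using cyc3_inverse_mem cyc3_rotate_mem by (metis distinct_length_2_or_more distinct_singleton)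

text \<open>In general, conjugating \<open>cyc3 q s t\<close> by \<open>cyc3 p r q\<close> replaces
  \<open>q\<close> by \<open>p\<close> and leaves \<open>s\<close> and \<open>t\<close> alone. The
  other cases are coincidences among the third points.\<close>

lemma cyc3_rel_trans:
  assumes "cyc3_rel H p q" "cyc3_rel H q s"
  shows "cyc3_rel H p s"
proof (cases "p = q \<or> q = s \<or> p = s")
  case True then show ?thesis using assms by (auto simp: cyc3_rel_def)
next
  case False
  obtain r where r: "cyc3 p q r \<in> H" "distinct [p,q,r]" using assms(1) False by (auto simp: cyc3_rel_def)
  obtain t where t: "cyc3 q s t \<in> H" "distinct [q,s,t]" using assms(2) False by (auto simp: cyc3_rel_def)
  have r': "cyc3 q r p \<in> H" "cyc3 r p q \<in> H" "cyc3 p r q \<in> H" "cyc3 r q p \<in> H"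
    using r cyc3_rotate_mem[of p q r] cyc3_rotate_mem[of q r p] cyc3_inverse_mem[of p q r] cyc3_inverse_mem[of r p q]
    by auto
  have t': "cyc3 s t q \<in> H" "cyc3 t q s \<in> H" using t cyc3_rotate_mem[of q s t] cyc3_rotate_mem[of s t q] by auto
  consider "r = s" | "t = p" | "r \<noteq> s" "t \<noteq> p" "r = t" | "r \<noteq> s" "t \<noteq> p" "r \<noteq> t" by blast
  then show ?thesis
  proof cases
    case 1 then show ?thesis using r' r by (auto simp: cyc3_rel_def)
  next
    case 2 then show ?thesis using t' t cyc3_inverse_mem[of p q s] False by (auto simp: cyc3_rel_def)
  next
    case 3
    then have "cyc3 r p s \<in> H" using cyc3_exchange'[of r q p s] r' t' r t False by auto
    then have "cyc3 p s r \<in> H" using cyc3_rotate_mem[of r p s] r 3 False by auto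
    then show ?thesis using 3 r False by (auto simp: cyc3_rel_def)
  next
    case 4
    have "cyc3 p s t \<in> H"
      using cyc3_conj_mem[OF t(1) r'(3)] r t 4 False by (auto simp: cyc3_def[of p r q])
    then show ?thesis using 4 t False by (auto simp: cyc3_rel_def)
  qed
qed

text \<open>Pairwise relations use auxiliary third points \<open>u\<close> and \<open>v\<close>;
  these are eliminated here, so that a block carries all its own 3-cycles. In the last case
  conjugation yields \<open>cyc3 u p s\<close>, which shares an arrow with
  \<open>cyc3 u p q\<close>.\<close>

lemma cyc3_mem_if_related:
  assumes "cyc3_rel H p q" "cyc3_rel H q s" "distinct [p,q,s]"
  shows "cyc3 p q s \<in> H"
proof -
  obtain u where u: "cyc3 p q u \<in> H" "distinct [p,q,u]" using assms by (auto simp: cyc3_rel_def)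
  obtain v where v: "cyc3 q s v \<in> H" "distinct [q,s,v]" using assms by (auto simp: cyc3_rel_def)
  have v': "cyc3 s v q \<in> H" "cyc3 v q s \<in> H" using v cyc3_rotate_mem[of q s v] cyc3_rotate_mem[of s v q] by auto
  have u': "cyc3 q u p \<in> H" "cyc3 u p q \<in> H" "cyc3 u q p \<in> H"
    using u cyc3_rotate_mem[of p q u] cyc3_rotate_mem[of q u p] cyc3_inverse_mem[of u p q] by auto
  consider "u = s" | "u \<noteq> s" "v = p" | "u \<noteq> s" "v = u" | "u \<noteq> s" "v \<noteq> p" "v \<noteq> u" by blast
  then show ?thesis
  proof cases
    case 1 then show ?thesis using u by simp
  next
    case 2 then show ?thesis using v' by simp
  next
    case 3
    then have "cyc3 q p s \<in> H" using cyc3_exchange[of u q p s] u' v' u v assms(3) by auto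
    then have "cyc3 q s p \<in> H" using cyc3_inverse_mem[of q p s] assms(3) by auto
    then show ?thesis using cyc3_rotate[of p q s] assms(3) by simp
  next
    case 4
    have "cyc3 p s u \<in> H"
      using cyc3_conj_mem[OF u(1) v] u v 4 assms(3) by (auto simp: cyc3_def[of q s v])
    then have "cyc3 u p s \<in> H" using cyc3_rotate[of u p s] 4 u assms(3) by auto
    then have "cyc3 p q s \<in> H" using cyc3_exchange[of u p q s] u' u 4 assms(3) by auto
    then show ?thesis .
  qed
qed

end

section \<open>Counting estimates\<close>

text \<open>Pascal's rule, starting from the equality \<open>5 choose 2 = 10\<close>: each step
  needs an increase of only 2. It shows that a block of intermediate size has too many
  translates.\<close>

lemma binomial_ge_double:
  assumes "5 \<le> m" "2 \<le> j" "j + 2 \<le> m"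
  shows "2 * m \<le> m choose j"
  using assms
proof (induction m arbitrary: j rule: dec_induct)
  case base
  then have "j = 2 \<or> j = 3" by linarith
  then show ?case by (auto simp: eval_nat_numeral)
next
  case (step k)
  obtain i where i: "j = Suc i" using step.prems by (cases j) auto
  have S: "Suc k choose j = (k choose i) + (k choose j)" using i by simp
  consider "j = 2" | "j + 1 = k" "j > 2" | "j > 2" "j + 2 \<le> k" using step.prems by linarith
  then show ?case
  proof cases
    case 1
    then have "2 * k \<le> k choose j" using step by simp
    moreover have "k choose i = k" using i 1 by auto
    ultimately show ?thesis unfolding S using step.hyps by simp
  next
    case 2
    then have "2 * k \<le> k choose i" using step.IH[of i] i by simp
    moreover have "k choose j = k" using 2 binomial_symmetric[of j k] by auto
    ultimately show ?thesis unfolding S using step.hyps by simp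
  next
    case 3
    then have "2 * k \<le> k choose i" "2 * k \<le> k choose j" using step.IH[of i] step.IH[of j] i by auto
    then show ?thesis unfolding S using step.hyps by simp
  qed
qed

lemma fact_ge_linear: "4 \<le> g \<Longrightarrow> 4 * g \<le> (fact g :: nat)"
proof (induction g rule: dec_induct)
  case (step g)
  have "4 \<le> (fact g :: nat)" using step.IH step.hyps by linarith
  then have "Suc g * 4 \<le> Suc g * fact g" by (rule mult_le_mono2)
  then show ?case by simp
qed (simp add: eval_nat_numeral)

lemma ex_permutes_image:
  assumes "finite U" "B \<subseteq> U" "D \<subseteq> U" "card B = card D"
  obtains g where "g permutes U" "g ` B = D"
proof -
  have fin: "finite B" "finite D" using assms finite_subset by auto
  obtain f where f: "bij_betw f B D" using finite_same_card_bij[OF fin assms(4)] by blast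
  have "card (U - B) = card (U - D)" using assms fin by (simp add: card_Diff_subset)
  then obtain f' where f': "bij_betw f' (U - B) (U - D)"
    using finite_same_card_bij assms(1) by (metis finite_Diff)
  define g where "g x = (if x \<in> B then f x else if x \<in> U then f' x else x)" for x
  have gB: "bij_betw g B D" using f by (simp add: g_def bij_betw_def inj_on_def image_def)
  moreover have "bij_betw g (U - B) (U - D)"
    using f' bij_betw_cong[of "U - B" g f' "U - D"] by (simp add: g_def)
  ultimately have "bij_betw g (B \<union> (U - B)) (D \<union> (U - D))"
    by (rule bij_betw_combine) auto
  then have "bij_betw g U U" using assms by (simp add: Un_absorb1)
  then have "g permutes U" by (rule bij_imp_permutes) (use assms in \<open>auto simp: g_def\<close>)
  then show thesis using that gB by (simp add: bij_betw_def)
qed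

section \<open>Point stabilisers and their blocks\<close>

context faithful_sym_action
begin

definition stab :: "'a \<Rightarrow> (nat \<Rightarrow> nat) set" where
  "stab y = {g. g permutes {1..n} \<and> \<theta> g y = y}"

definition cyc3_class :: "'a \<Rightarrow> nat \<Rightarrow> nat set" where
  "cyc3_class y p = {q \<in> {1..n}. cyc3_rel (stab y) p q}"

lemma stab_comp: "g \<in> stab y \<Longrightarrow> h \<in> stab y \<Longrightarrow> g \<circ> h \<in> stab y"
  by (auto simp: stab_def comp permutes_compose)

lemma theta_inv_cancel:
  assumes "g permutes {1..n}"
  shows "\<theta> (inv g) (\<theta> g y) = y" "\<theta> g (\<theta> (inv g) y) = y"
  using comp[OF permutes_inv[OF assms] assms] comp[OF assms permutes_inv[OF assms]]
    permutes_inv_o[OF assms] by (metis comp_apply id_apply theta_id)+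

lemma stab_inv: "g \<in> stab y \<Longrightarrow> inv g \<in> stab y"
  using theta_inv_cancel(1)[of g y] by (auto simp: stab_def permutes_inv)

lemma coset_mem_stab:
  assumes "g permutes {1..n}" "h permutes {1..n}" "\<theta> g y = \<theta> h y"
  shows "inv h \<circ> g \<in> stab y"
  using assms theta_inv_cancel(1)[OF assms(2), of y] comp[OF permutes_inv[OF assms(2)] assms(1)]
  by (simp add: stab_def permutes_compose permutes_inv)

text \<open>Moving \<open>y\<close> by \<open>g\<close> conjugates its stabiliser by
  \<open>g\<close>, which relabels the entries of a 3-cycle.\<close>

lemma stab_image_cyc3:
  assumes g: "g permutes {1..n}" and c: "cyc3 p q r \<in> stab y"
  shows "cyc3 (g p) (g q) (g r) \<in> stab (\<theta> g y)"
proof -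
  have cp: "cyc3 p q r permutes {1..n}" "\<theta> (cyc3 p q r) y = y" using c by (auto simp: stab_def)
  have eq: "cyc3 (g p) (g q) (g r) = g \<circ> cyc3 p q r \<circ> inv g"
    using cyc3_conj[OF permutes_inj[OF g], of p q r] permutes_inv_o(1)[OF g] by (simp add: comp_assoc)
  have "g \<circ> cyc3 p q r \<circ> inv g permutes {1..n}" using g cp by (simp add: permutes_compose permutes_inv)
  moreover have "\<theta> (g \<circ> cyc3 p q r \<circ> inv g) (\<theta> g y) = \<theta> g y"
    using g cp theta_inv_cancel(1)[OF g] by (simp add: comp permutes_compose permutes_inv)
  ultimately show ?thesis using eq by (simp add: stab_def)
qed

lemma cyc3_rel_image:
  assumes g: "g permutes {1..n}" and "cyc3_rel (stab y) p q"
  shows "cyc3_rel (stab (\<theta> g y)) (g p) (g q)"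
proof -
  have eq: "g u = g v \<longleftrightarrow> u = v" for u v using permutes_inj[OF g] by (simp add: inj_eq)
  show ?thesis
    using assms(2) stab_image_cyc3[OF g] unfolding cyc3_rel_def by (auto simp: eq) (metis eq)
qed

text \<open>This equivariance lets one block be moved to other sets of the same size, and shows that
  elements of the stabiliser of \<open>y\<close> permute the blocks of \<open>y\<close>.\<close>

lemma cyc3_class_image:
  assumes g: "g permutes {1..n}"
  shows "cyc3_class (\<theta> g y) (g p) = g ` cyc3_class y p"
proof
  show "g ` cyc3_class y p \<subseteq> cyc3_class (\<theta> g y) (g p)"
    using cyc3_rel_image[OF g] permutes_in_image[OF g] by (auto simp: cyc3_class_def)
  show "cyc3_class (\<theta> g y) (g p) \<subseteq> g ` cyc3_class y p"
  proof
    fix q assume q: "q \<in> cyc3_class (\<theta> g y) (g p)"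
    then have "cyc3_rel (stab (\<theta> (inv g) (\<theta> g y))) (inv g (g p)) (inv g q)"
      using cyc3_rel_image[OF permutes_inv[OF g]] by (simp add: cyc3_class_def)
    then have "inv g q \<in> cyc3_class y p"
      using q permutes_in_image[OF permutes_inv[OF g], of q] permutes_inverses[OF g] theta_inv_cancel[OF g]
      by (simp add: cyc3_class_def)
    then show "q \<in> g ` cyc3_class y p" using permutes_inverses(1)[OF g, of q] by (metis imageI)
  qed
qed

lemma cyc3_class_eq:
  assumes "q \<in> cyc3_class y p"
  shows "cyc3_class y q = cyc3_class y p"
  using assms cyc3_rel_sym[OF stab_comp] cyc3_rel_trans[OF stab_comp]
  unfolding cyc3_class_def by blast

text \<open>Permutations of \<open>\<Gamma>\<close> lie in distinct cosets of the stabiliser, hence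
  send \<open>y\<close> to distinct points.\<close>

lemma fact_le_card_Y:
  assumes "y \<in> Y" "\<Gamma> \<subseteq> {1..n}" "\<And>g. g permutes \<Gamma> \<Longrightarrow> g \<in> stab y \<Longrightarrow> g = id"
  shows "fact (card \<Gamma>) \<le> card Y"
proof -
  have fin: "finite \<Gamma>" using assms(2) finite_subset by blast
  have sub: "g permutes {1..n}" if "g permutes \<Gamma>" for g using that assms(2) by (rule permutes_subset)
  have "inj_on (\<lambda>g. \<theta> g y) {g. g permutes \<Gamma>}"
  proof (rule inj_onI)
    fix g h assume gh: "g \<in> {g. g permutes \<Gamma>}" "h \<in> {g. g permutes \<Gamma>}" "\<theta> g y = \<theta> h y"
    then have "inv h \<circ> g \<in> stab y" using coset_mem_stab sub by blast
    moreover have "inv h \<circ> g permutes \<Gamma>" using gh by (simp add: permutes_compose permutes_inv)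
    ultimately have "inv h \<circ> g = id" using assms(3) by blast
    then have "inv h (g x) = inv h (h x)" for x
      using gh(2) by (simp add: fun_eq_iff permutes_inverses)
    moreover have "inj (inv h)" using gh(2) permutes_inv permutes_inj by blast
    ultimately show "g = h" by (auto simp: fun_eq_iff dest: injD)
  qed
  moreover have "(\<lambda>g. \<theta> g y) ` {g. g permutes \<Gamma>} \<subseteq> Y"
    using permutes_in_image[OF permutes_Y[OF sub]] assms(1) by blast
  ultimately have "card {g. g permutes \<Gamma>} \<le> card Y" using card_inj_on_le finite_Y by blast
  then show ?thesis using card_permutations[OF refl fin] by simp
qed

text \<open>Bochert's argument: take a largest set whose symmetric group meets the stabiliser trivially.
  If it has fewer than \<open>n/2\<close> points, then two elements of the stabiliser have supports meeting in
  exactly one point, and their commutator is a 3-cycle.\<close>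

lemma small_degree_cyc3_in_stab:
  assumes "7 \<le> n" "y \<in> Y" "card Y < 2 * n - 2"
  obtains a b c where "distinct [a,b,c]" "cyc3 a b c \<in> stab y"
proof -
  define T where "T = {\<Gamma>. \<Gamma> \<subseteq> {1..n} \<and> (\<forall>g. g permutes \<Gamma> \<longrightarrow> g \<in> stab y \<longrightarrow> g = id)}"
  have finT: "finite T" by (rule finite_subset[of _ "Pow {1..n}"]) (auto simp: T_def)
  have neT: "{} \<in> T" by (simp add: T_def)
  have "Max (card ` T) \<in> card ` T" using finT neT by (intro Max_in) auto
  then obtain \<Gamma> where \<Gamma>: "\<Gamma> \<in> T" "card \<Gamma> = Max (card ` T)" by auto
  have max: "card \<Delta> \<le> card \<Gamma>" if "\<Delta> \<in> T" for \<Delta> using \<Gamma>(2) finT that by simp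
  have sub: "\<Gamma> \<subseteq> {1..n}" and triv: "\<And>g. g permutes \<Gamma> \<Longrightarrow> g \<in> stab y \<Longrightarrow> g = id"
    using \<Gamma>(1) by (auto simp: T_def)
  have fin: "finite \<Gamma>" using sub finite_subset by blast
  have "fact (card \<Gamma>) < 2 * n - 2" using fact_le_card_Y[OF assms(2) sub triv] assms(3) by simp
  \<comment> \<open>If \<open>card \<Gamma>\<close> were at least \<open>n / 2\<close>, it would be
    at least 4, and its factorial would be at least \<open>4 * card \<Gamma>\<close>, hence at least
    \<open>2 * n\<close>.\<close>
  then have small: "2 * card \<Gamma> < n"
    using fact_ge_linear[of "card \<Gamma>"] assms(1) by linarith
  have "card ({1..n} - \<Gamma>) = n - card \<Gamma>" using sub fin by (simp add: card_Diff_subset)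
  \<comment> \<open>The complement is larger than the maximal set \<open>\<Gamma>\<close>, so it
    supports a nontrivial element \<open>h\<close> of the stabiliser.\<close>
  then have "{1..n} - \<Gamma> \<notin> T" using max[of "{1..n} - \<Gamma>"] small by linarith
  then obtain h where h: "h permutes {1..n} - \<Gamma>" "h \<in> stab y" "h \<noteq> id" by (auto simp: T_def)
  then obtain x where x: "h x \<noteq> x" by (auto simp: fun_eq_iff)
  have sh: "supp h \<subseteq> {1..n} - \<Gamma>" using supp_permutes_subset[OF h(1)] .
  then have xin: "x \<in> {1..n}" "x \<notin> \<Gamma>" using x in_supp_iff[of x h] by auto
  have "card (insert x \<Gamma>) = Suc (card \<Gamma>)" using fin xin by simp
  \<comment> \<open>Enlarging \<open>\<Gamma>\<close> by a point moved by \<open>h\<close> gives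
    \<open>k\<close>, which must move this new point because \<open>\<Gamma>\<close> alone supports
    nothing nontrivial in the stabiliser.\<close>
  then have "insert x \<Gamma> \<notin> T" using max[of "insert x \<Gamma>"] by linarith
  then obtain k where k: "k permutes insert x \<Gamma>" "k \<in> stab y" "k \<noteq> id" using sub xin by (auto simp: T_def)
  have kx: "k x \<noteq> x"
  proof
    assume "k x = x"
    then have "k permutes \<Gamma>" by (intro permutes_superset[OF k(1)]) auto
    then show False using triv k by blast
  qed
  have sk: "supp k \<subseteq> insert x \<Gamma>" using supp_permutes_subset[OF k(1)] .
  have "supp h \<inter> supp k = {x}" using sh sk x kx by (auto simp: in_supp_iff)
  then have "h \<circ> k \<circ> inv h \<circ> inv k = cyc3 x (h x) (k x)"
    by (rule commutator_eq_cyc3[OF permutes_bij[OF h(1)] permutes_bij[OF k(1)]])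
  moreover have "h \<circ> k \<circ> inv h \<circ> inv k \<in> stab y" using h k by (intro stab_comp stab_inv)
  moreover have "h x \<noteq> k x"
  proof
    assume e: "h x = k x"
    have "h x \<in> supp h" "k x \<in> supp k"
      using x kx image_in_supp[OF permutes_inj[OF h(1)]] image_in_supp[OF permutes_inj[OF k(1)]]
      by (auto simp: in_supp_iff)
    then show False using e \<open>supp h \<inter> supp k = {x}\<close> x by auto
  qed
  ultimately show thesis using that[of x "h x" "k x"] x kx by auto
qed

text \<open>By equivariance every set of \<open>Suc j\<close> points containing 1 is the block of 1
  for some point of \<open>Y\<close>. These sets correspond to the \<open>j\<close>-element subsets
  of \<open>{2..n}\<close>.\<close>

lemma card_Y_ge_binomial:
  assumes "n > 0" "y \<in> Y" "card (cyc3_class y p) = Suc j"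
  shows "(n - 1) choose j \<le> card Y"
proof -
  let ?B = "cyc3_class y p"
  let ?\<D> = "(\<lambda>D. insert 1 D) ` {D. D \<subseteq> {2..n} \<and> card D = j}"
  have "?\<D> \<subseteq> (\<lambda>z. cyc3_class z 1) ` Y"
  proof
    fix D assume "D \<in> ?\<D>"
    then obtain D' where D': "D = insert 1 D'" "D' \<subseteq> {2..n}" "card D' = j" by blast
    have "card D = Suc j" using D' finite_subset[of D' "{2..n}"] by (subst D'(1), subst card_insert_disjoint) auto
    moreover have "D \<subseteq> {1..n}" using D' assms(1) by auto
    moreover have "?B \<subseteq> {1..n}" by (auto simp: cyc3_class_def)
    ultimately obtain g where g: "g permutes {1..n}" "g ` ?B = D"
      using ex_permutes_image[of "{1..n}" ?B D] assms(3) by (metis finite_atLeastAtMost)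
    then have "1 \<in> g ` ?B" using D'(1) by blast
    then obtain q where q: "q \<in> ?B" "g q = 1" by fastforce
    then have "cyc3_class (\<theta> g y) 1 = D"
      using cyc3_class_image[OF g(1), of y q] cyc3_class_eq[OF q(1)] g(2) by simp
    moreover have "\<theta> g y \<in> Y" using permutes_in_image[OF permutes_Y[OF g(1)]] assms(2) by blast
    ultimately show "D \<in> (\<lambda>z. cyc3_class z 1) ` Y" by blast
  qed
  then have "card ?\<D> \<le> card Y" using surj_card_le[OF finite_Y] by blast
  moreover have "inj_on (insert 1) {D. D \<subseteq> {2..n} \<and> card D = j}"
  proof (rule inj_onI)
    fix D E :: "nat set"
    assume "D \<in> {D. D \<subseteq> {2..n} \<and> card D = j}" "E \<in> {D. D \<subseteq> {2..n} \<and> card D = j}"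
      and eq: "insert 1 D = insert 1 E"
    then have "1 \<notin> D" "1 \<notin> E" by auto
    then show "D = E" using eq insert_ident by metis
  qed
  then have "card ?\<D> = (n - 1) choose j"
    using n_subsets[of "{2..n}" j] by (simp add: card_image)
  ultimately show ?thesis by simp
qed

text \<open>The one point outside the block is a block by itself. The stabiliser permutes the
  blocks, and the big block has at least two points, so the singleton is preserved.\<close>

lemma stab_fixes_point:
  assumes "card (cyc3_class y p) + 1 = n" "3 \<le> n"
  obtains i where "i \<in> {1..n}" "\<And>g. g \<in> stab y \<Longrightarrow> g i = i"
proof -
  let ?B = "cyc3_class y p"
  have B: "?B \<subseteq> {1..n}" by (auto simp: cyc3_class_def)
  then have "card ({1..n} - ?B) = 1" using assms(1) finite_subset[OF B] by (simp add: card_Diff_subset)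
  then obtain i where i: "{1..n} - ?B = {i}" by (auto simp: card_1_singleton_iff)
  have "g i = i" if g: "g \<in> stab y" for g
  proof (rule ccontr)
    assume gi: "g i \<noteq> i"
    have gp: "g permutes {1..n}" "\<theta> g y = y" using g by (auto simp: stab_def)
    define j where "j = inv g i"
    have gj: "g j = i" using permutes_inverses(1)[OF gp(1)] by (simp add: j_def)
    have "j \<in> {1..n}" using permutes_in_image[OF permutes_inv[OF gp(1)], of i] i unfolding j_def by blast
    moreover have "j \<noteq> i" using gj gi by blast
    ultimately have j: "j \<in> ?B" using i by blast
    have "\<not> ?B \<subseteq> {j}" using card_mono[of "{j}" ?B] assms by auto
    then obtain k where k: "k \<in> ?B" "k \<noteq> j" by blast
    have "g k \<noteq> i" using k gj permutes_inj[OF gp(1)] by (auto dest: injD)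
    moreover have "g k \<in> {1..n}" using permutes_in_image[OF gp(1), of k] k(1) B by blast
    ultimately have "g k \<in> ?B" using i by blast
    moreover have "g k \<in> cyc3_class y i"
      using cyc3_class_image[OF gp(1), of y j] gp(2) gj k cyc3_class_eq[OF j] by auto
    ultimately have "cyc3_class y i = ?B"
      using cyc3_class_eq[of "g k" y i] cyc3_class_eq[of "g k" y p] by simp
    moreover have "i \<in> {1..n}" "i \<notin> ?B" using i by blast+
    moreover have "i \<in> cyc3_class y i" using \<open>i \<in> {1..n}\<close> by (simp add: cyc3_class_def cyc3_rel_def)
    ultimately show False by blast
  qed
  then show thesis using that[of i] i by blast
qed

text \<open>Sending \<open>\<theta> g y\<close> to \<open>g i\<close> is a well-defined equivariant
  map from the orbit of \<open>y\<close> to \<open>{1..n}\<close>, and points over a moved point are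
  moved. The transposition of \<open>i\<close> and \<open>p\<close> selects one point over each
  \<open>p\<close>.\<close>

lemma card_supp_le_of_fixed_point:
  assumes "y \<in> Y" "i \<in> {1..n}" and fixes_i: "\<And>g. g \<in> stab y \<Longrightarrow> g i = i" and \<sigma>: "\<sigma> permutes {1..n}"
  shows "card (supp \<sigma>) \<le> card (supp (\<theta> \<sigma>))"
proof (rule card_inj_on_le)
  have t: "transpose i p permutes {1..n}" if "p \<in> supp \<sigma>" for p
    using that assms(2) supp_permutes_subset[OF \<sigma>] by (intro permutes_swap_id) auto
  show "inj_on (\<lambda>p. \<theta> (transpose i p) y) (supp \<sigma>)"
  proof (rule inj_onI)
    fix p q assume pq: "p \<in> supp \<sigma>" "q \<in> supp \<sigma>" "\<theta> (transpose i p) y = \<theta> (transpose i q) y"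
    then have "(inv (transpose i q) \<circ> transpose i p) i = i"
      by (intro fixes_i coset_mem_stab t)
    then have "transpose i q p = i" by simp
    then show "p = q" by (metis transpose_apply_first transpose_involutory)
  qed
  show "(\<lambda>p. \<theta> (transpose i p) y) ` supp \<sigma> \<subseteq> supp (\<theta> \<sigma>)"
  proof clarify
    fix p assume p: "p \<in> supp \<sigma>"
    show "\<theta> (transpose i p) y \<in> supp (\<theta> \<sigma>)"
    proof (rule ccontr)
      assume "\<theta> (transpose i p) y \<notin> supp (\<theta> \<sigma>)"
      then have "\<theta> (\<sigma> \<circ> transpose i p) y = \<theta> (transpose i p) y"
        using comp[OF \<sigma> t[OF p]] by (simp add: in_supp_iff)
      then have "(inv (transpose i p) \<circ> (\<sigma> \<circ> transpose i p)) i = i"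
        by (intro fixes_i coset_mem_stab permutes_compose t[OF p] \<sigma>)
      then have "transpose i p (\<sigma> p) = i" by simp
      then have "\<sigma> p = p" by (metis transpose_apply_first transpose_involutory)
      then show False using p by (simp add: in_supp_iff)
    qed
  qed
  show "finite (supp (\<theta> \<sigma>))" using finite_supp[OF \<sigma>] .
qed

text \<open>If \<open>Y\<close> has at least \<open>2 * n - 2\<close> points, two moved points
  already suffice. Otherwise a block of size \<open>n - 1\<close> is found, and comparison with the
  natural action gives the bound.\<close>

lemma degree_lower_bound_large:
  assumes "7 \<le> n" and \<sigma>: "\<sigma> permutes {1..n}" "\<sigma> \<noteq> id"
  shows "n + card (supp \<sigma>) \<le> card Y + card (supp (\<theta> \<sigma>))"
proof (cases "2 * n - 2 \<le> card Y")
  case True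
  have "card (supp \<sigma>) \<le> n" using card_mono[OF _ supp_permutes_subset[OF \<sigma>(1)]] by simp
  then show ?thesis using True card_supp_ge_2[OF \<sigma>] assms(1) by linarith
next
  case False
  let ?c = "cyc3 (1::nat) 2 3"
  have c: "?c permutes {1..n}" using assms(1) by (intro cyc3_permutes) auto
  moreover have "?c 1 \<noteq> 1" by (simp add: cyc3_def)
  ultimately have "\<theta> ?c \<noteq> id" using faithful[OF c] by auto
  \<comment> \<open>The point is chosen outside the fixed points of one 3-cycle, so that its
    stabiliser cannot have a single block of size \<open>n\<close>.\<close>
  then obtain y where y: "\<theta> ?c y \<noteq> y" by (auto simp: fun_eq_iff)
  then have yY: "y \<in> Y" using supp_subset[OF c] by (auto simp: in_supp_iff)
  obtain a b d where abd: "distinct [a,b,d]" "cyc3 a b d \<in> stab y"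
    using small_degree_cyc3_in_stab[OF assms(1) yY] False by (metis not_le)
  let ?B = "cyc3_class y a"
  have B: "?B \<subseteq> {1..n}" by (auto simp: cyc3_class_def)
  have moved: "{a,b,d} \<subseteq> {1..n}"
  proof -
    have "{a,b,d} \<subseteq> supp (cyc3 a b d)" using abd(1) by (auto simp: in_supp_iff cyc3_def)
    then show ?thesis using supp_permutes_subset abd(2) by (fastforce simp: stab_def)
  qed
  have "cyc3 a d b \<in> stab y" using cyc3_inverse_mem[OF stab_comp abd(2,1)] .
  then have "{a,b,d} \<subseteq> ?B" using abd moved by (auto simp: cyc3_class_def cyc3_rel_def)
  then have "card {a,b,d} \<le> card ?B" using finite_subset[OF B] by (intro card_mono) auto
  then have ge3: "3 \<le> card ?B" using abd(1) by simp
  have "n - 1 \<le> card ?B"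
  proof (rule ccontr)
    assume "\<not> n - 1 \<le> card ?B"
    \<comment> \<open>A block size from 3 to \<open>n - 2\<close> gives a lower index from 2 to
      \<open>(n - 1) - 2\<close>, as the binomial estimate requires.\<close>
    then have "2 * (n - 1) \<le> (n - 1) choose (card ?B - 1)"
      using ge3 assms(1) by (intro binomial_ge_double) auto
    also have "\<dots> \<le> card Y"
      using card_Y_ge_binomial[OF _ yY, of a "card ?B - 1"] ge3 assms(1) by auto
    finally show False using False by simp
  qed
  moreover have "card ?B \<noteq> n"
  proof
    assume "card ?B = n"
    then have all: "?B = {1..n}" using card_subset_eq[OF _ B] by simp
    have mem: "1 \<in> ?B" "2 \<in> ?B" "3 \<in> ?B" using all assms(1) by auto
    have "2 \<in> cyc3_class y 1" "3 \<in> cyc3_class y 2"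
      unfolding cyc3_class_eq[OF mem(1)] cyc3_class_eq[OF mem(2)] by (fact mem)+
    then have rel: "cyc3_rel (stab y) 1 2" "cyc3_rel (stab y) 2 3"
      unfolding cyc3_class_def by blast+
    have "?c \<in> stab y" by (rule cyc3_mem_if_related[OF stab_comp rel]) simp_all
    then show False using y by (simp add: stab_def)
  qed
  moreover have "card ?B \<le> n" using card_mono[OF _ B] by simp
  ultimately have "card ?B + 1 = n" using assms(1) by linarith
  then obtain i where i: "i \<in> {1..n}" "\<And>g. g \<in> stab y \<Longrightarrow> g i = i"
    by (rule stab_fixes_point) (use assms(1) in simp, blast)
  have "card (supp \<sigma>) \<le> card (supp (\<theta> \<sigma>))"
    by (rule card_supp_le_of_fixed_point[OF yY i(1) _ \<sigma>(1)]) (rule i(2))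
  moreover have "n \<le> card Y" using card_Y_ge assms(1) by simp
  ultimately show ?thesis by simp
qed

end

section \<open>The outer action of the symmetric group of degree 6\<close>

text \<open>The six synthematic totals, i.e. the 1-factorisations of the complete graph on \<open>{1..6}\<close>;
  the symmetric group of degree 6 acts on them through its outer automorphism.\<close>

definition totals :: "nat set set set set" where
  "totals = set (map (\<lambda>t. set (map (\<lambda>s. set (map (\<lambda>(a,b). {a,b}) s)) t))
  [[[(1,2),(3,4),(5,6)], [(1,3),(2,5),(4,6)], [(1,4),(2,6),(3,5)], [(1,5),(2,4),(3,6)], [(1,6),(2,3),(4,5)]],
   [[(1,2),(3,4),(5,6)], [(1,3),(2,6),(4,5)], [(1,4),(2,5),(3,6)], [(1,5),(2,3),(4,6)], [(1,6),(2,4),(3,5)]],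
   [[(1,2),(3,5),(4,6)], [(1,3),(2,4),(5,6)], [(1,4),(2,5),(3,6)], [(1,5),(2,6),(3,4)], [(1,6),(2,3),(4,5)]],
   [[(1,2),(3,5),(4,6)], [(1,3),(2,6),(4,5)], [(1,4),(2,3),(5,6)], [(1,5),(2,4),(3,6)], [(1,6),(2,5),(3,4)]],
   [[(1,2),(3,6),(4,5)], [(1,3),(2,4),(5,6)], [(1,4),(2,6),(3,5)], [(1,5),(2,3),(4,6)], [(1,6),(2,5),(3,4)]],
   [[(1,2),(3,6),(4,5)], [(1,3),(2,5),(4,6)], [(1,4),(2,3),(5,6)], [(1,5),(2,6),(3,4)], [(1,6),(2,4),(3,5)]]])"

text \<open>The nested images act on duads (pairs of points), on synthemes (partitions into three
  duads) and on the total itself.\<close>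

definition act_total :: "(nat \<Rightarrow> nat) \<Rightarrow> nat set set set \<Rightarrow> nat set set set" where
  "act_total g T = (\<lambda>s. (\<lambda>d. g ` d) ` s) ` T"

lemma act_total_comp: "act_total (g \<circ> h) T = act_total g (act_total h T)"
  by (simp add: act_total_def image_comp comp_def image_image)

lemma act_total_id: "act_total id T = T"
  by (simp add: act_total_def)

lemma card_totals: "card totals = 6"
  by code_simp

text \<open>The transpositions involving 1 generate the symmetric group, so this finite check yields
  invariance under all permutations. The index range is a list so that it can be enumerated.\<close>

lemma act_total_generators: "\<forall>b\<in>set [2,3,4,5,6]. \<forall>T\<in>totals. act_total (transpose 1 b) T \<in> totals"
  by code_simp

lemma act_total_transpose:
  assumes "a \<in> {1..6}" "b \<in> {1..6}" "T \<in> totals"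
  shows "act_total (transpose a b) T \<in> totals"
proof -
  have gen: "act_total (transpose 1 c) U \<in> totals" if "c \<in> {1..6}" "U \<in> totals" for c U
  proof (cases "c = 1")
    case True then show ?thesis using that act_total_id by simp
  next
    case False
    then have "c \<in> set [2,3,4,5,6]" using that(1) by auto
    then show ?thesis using act_total_generators that(2) by blast
  qed
  consider "a = b" | "b = 1" | "a \<noteq> b" "b \<noteq> 1" by blast
  then show ?thesis
  proof cases
    case 1 then show ?thesis using assms(3) act_total_id by simp
  next
    case 2 then show ?thesis using gen[OF assms(1,3)] by (simp add: transpose_commute)
  next
    case 3
    have "transpose a b = transpose 1 a \<circ> (transpose 1 b \<circ> transpose 1 a)"
      using 3 by (auto simp: fun_eq_iff transpose_def)
    then show ?thesis using gen assms by (simp only: act_total_comp)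
  qed
qed

lemma act_total_mem:
  assumes "g permutes {1..6}" "T \<in> totals"
  shows "act_total g T \<in> totals"
proof -
  have "\<forall>T\<in>totals. act_total g T \<in> totals"
    using assms(1) finite_atLeastAtMost
    by (induction rule: permutes_induct)
      (auto simp only: act_total_id act_total_comp intro!: act_total_transpose)
  then show ?thesis using assms(2) by blast
qed

text \<open>The first of three finite checks by which each syntheme, duad and point is the only
  common member of two objects one level up.\<close>

lemma synthemes_from_totals: "\<forall>s\<in>\<Union>totals. \<exists>T\<in>totals. \<exists>T'\<in>totals. T \<inter> T' = {s}"
  by code_simp

lemma duads_from_synthemes: "\<forall>d\<in>\<Union>(\<Union>totals). \<exists>s\<in>\<Union>totals. \<exists>s'\<in>\<Union>totals. s \<inter> s' = {d}"
  by code_simp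

lemma points_from_duads: "\<forall>p\<in>set [1,2,3,4,5,6]. \<exists>d\<in>\<Union>(\<Union>totals). \<exists>d'\<in>\<Union>(\<Union>totals). d \<inter> d' = {p}"
  by code_simp

lemma fixed_if_Int_singleton:
  assumes "inj f" "f ` A = A" "f ` B = B" "A \<inter> B = {x}"
  shows "f x = x"
  using image_Int[OF assms(1), of A B] assms(2-4) by auto

lemma inj_image: "inj f \<Longrightarrow> inj ((`) f)"
  by (simp add: inj_def inj_image_eq_iff)

text \<open>Fixed totals force fixed synthemes, these force fixed duads, and these force fixed
  points, since at each level an object is recovered as an intersection.\<close>

lemma act_total_faithful:
  assumes g: "g permutes {1..6}" and fix_totals: "\<And>T. T \<in> totals \<Longrightarrow> act_total g T = T"
  shows "g = id"
proof -
  have inj: "inj g" using g by (rule permutes_inj)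
  have syn: "(`) g ` s = s" if s: "s \<in> \<Union>totals" for s
  proof -
    obtain T T' where T: "T \<in> totals" "T' \<in> totals" "T \<inter> T' = {s}"
      using bspec[OF synthemes_from_totals s] by blast
    show ?thesis
      using fixed_if_Int_singleton[OF inj_image[OF inj_image[OF inj]], of T T' s]
        fix_totals[OF T(1)] fix_totals[OF T(2)] T(3) by (simp add: act_total_def)
  qed
  have duad: "g ` d = d" if d: "d \<in> \<Union>(\<Union>totals)" for d
  proof -
    obtain s s' where s: "s \<in> \<Union>totals" "s' \<in> \<Union>totals" "s \<inter> s' = {d}"
      using bspec[OF duads_from_synthemes d] by blast
    show ?thesis
      by (rule fixed_if_Int_singleton[OF inj_image[OF inj] syn[OF s(1)] syn[OF s(2)] s(3)])
  qed
  have "g p = p" if "p \<in> {1..6}" for p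
  proof -
    have p: "p \<in> set [1,2,3,4,5,6]" using that by auto
    obtain d d' where d: "d \<in> \<Union>(\<Union>totals)" "d' \<in> \<Union>(\<Union>totals)" "d \<inter> d' = {p}"
      using bspec[OF points_from_duads p] by blast
    show ?thesis by (rule fixed_if_Int_singleton[OF inj duad[OF d(1)] duad[OF d(2)] d(3)])
  qed
  moreover have "g p = p" if "p \<notin> {1..6}" for p using g that by (rule permutes_not_in)
  ultimately show ?thesis by (auto simp: fun_eq_iff)
qed

definition outer_action :: "(nat \<Rightarrow> nat) \<Rightarrow> nat set set set \<Rightarrow> nat set set set" where
  "outer_action g T = (if T \<in> totals then act_total g T else T)"

lemma faithful_sym_action_outer: "faithful_sym_action 6 totals outer_action"
proof
  show "finite totals" using card_totals by (intro card_ge_0_finite) simp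
next
  fix g :: "nat \<Rightarrow> nat" assume g: "g permutes {1..6}"
  have inj: "inj (act_total g)"
    using inj_image[OF inj_image[OF inj_image[OF permutes_inj[OF g]]]] by (simp add: act_total_def[abs_def])
  show "outer_action g permutes totals"
  proof (rule inj_imp_permutes)
    show "inj_on (outer_action g) totals"
      using inj by (auto simp: inj_on_def inj_def outer_action_def)
    show "finite totals" using card_totals by (intro card_ge_0_finite) simp
  qed (use act_total_mem[OF g] in \<open>auto simp: outer_action_def\<close>)
next
  fix g h :: "nat \<Rightarrow> nat" assume "g permutes {1..6}" "h permutes {1..6}"
  then show "outer_action (g \<circ> h) = outer_action g \<circ> outer_action h"
    using act_total_mem by (auto simp: fun_eq_iff outer_action_def act_total_comp)
next
  fix g :: "nat \<Rightarrow> nat" assume g: "g permutes {1..6}" "outer_action g = id"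
  have "act_total g T = T" if "T \<in> totals" for T
    using fun_cong[OF g(2), of T] that by (simp add: outer_action_def)
  then show "g = id" using act_total_faithful[OF g(1)] by blast
qed

text \<open>The relabelling \<open>p\<close> carries the totals moved by \<open>\<tau>\<close> onto
  those moved by \<open>\<sigma>\<close>, so one representative of each cycle type can be evaluated.
  \<open>Set.filter\<close> keeps the right side executable.\<close>

lemma card_supp_outer_action_conj:
  assumes p: "p permutes {1..6}" and "\<sigma> \<circ> p = p \<circ> \<tau>"
  shows "card (supp (outer_action \<sigma>)) = card (Set.filter (\<lambda>T. act_total \<tau> T \<noteq> T) totals)"
proof -
  have inj: "inj (act_total p)"
    using inj_image[OF inj_image[OF inj_image[OF permutes_inj[OF p]]]] by (simp add: act_total_def[abs_def])
  have sw: "act_total \<sigma> (act_total p T) = act_total p (act_total \<tau> T)" for T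
    using assms(2) by (metis act_total_comp)
  have "supp (outer_action \<sigma>) = act_total p ` Set.filter (\<lambda>T. act_total \<tau> T \<noteq> T) totals"
  proof (intro set_eqI iffI)
    fix T assume "T \<in> supp (outer_action \<sigma>)"
    then have T: "T \<in> totals" "act_total \<sigma> T \<noteq> T" by (auto simp: in_supp_iff outer_action_def split: if_splits)
    define U where "U = act_total (inv p) T"
    have U: "U \<in> totals" using act_total_mem[OF permutes_inv[OF p] T(1)] by (simp add: U_def)
    have pU: "T = act_total p U"
      using act_total_comp[of p "inv p" T] permutes_inv_o(1)[OF p] by (simp add: U_def act_total_id)
    then have "act_total \<tau> U \<noteq> U" using T(2) sw[of U] by auto
    then show "T \<in> act_total p ` Set.filter (\<lambda>T. act_total \<tau> T \<noteq> T) totals" using U pU by auto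
  next
    fix T assume "T \<in> act_total p ` Set.filter (\<lambda>T. act_total \<tau> T \<noteq> T) totals"
    then obtain U where U: "U \<in> totals" "act_total \<tau> U \<noteq> U" "T = act_total p U" by auto
    then have "act_total \<sigma> T \<noteq> T" using sw[of U] inj by (auto dest: injD)
    then show "T \<in> supp (outer_action \<sigma>)" using act_total_mem[OF p U(1)] U(3) by (simp add: in_supp_iff outer_action_def)
  qed
  then show ?thesis using card_image[OF inj_on_subset[OF inj]] by simp
qed

section \<open>Conjugation to standard cycle types\<close>

lemma relabel:
  assumes "distinct xs" "length xs = 6" "set xs \<subseteq> {1..6::nat}"
  obtains p where "p permutes {1..6}" "\<And>i. i \<in> {1..6} \<Longrightarrow> p i = xs ! (i - 1)"
proof -
  define p where "p i = (if i \<in> {1..6} then xs ! (i - 1) else i)" for i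
  have "p permutes {1..6}"
  proof (rule inj_imp_permutes)
    show "inj_on p {1..6}"
      using assms(1,2) by (auto simp: inj_on_def p_def nth_eq_iff_index_eq)
    fix i :: nat assume "i \<in> {1..6}"
    then have "xs ! (i - 1) \<in> set xs" using assms(2) by (intro nth_mem) auto
    then show "p i \<in> {1..6}" using \<open>i \<in> {1..6}\<close> assms(3) by (auto simp: p_def)
  qed (auto simp: p_def)
  then show thesis using that[of p] by (simp add: p_def)
qed

text \<open>Writing the cycles of \<open>\<sigma>\<close> over those of \<open>\<tau>\<close>
  defines the conjugating permutation. The shift by 1 occurs because points start at 1 and list
  positions at 0.\<close>

lemma relabel_conj:
  assumes \<sigma>: "\<sigma> permutes {1..6}" and xs: "distinct [a,b,c,d,e,f]" "set [a,b,c,d,e,f] \<subseteq> {1..6::nat}"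
    and \<tau>: "\<tau> permutes {1..6}" 
    and eq: "\<And>i. i \<in> {1..6} \<Longrightarrow> \<sigma> ([a,b,c,d,e,f] ! (i - 1)) = [a,b,c,d,e,f] ! (\<tau> i - 1)"
  obtains p where "p permutes {1..6}" "\<sigma> \<circ> p = p \<circ> \<tau>"
proof -
  obtain p where p: "p permutes {1..6}" "\<And>i. i \<in> {1..6} \<Longrightarrow> p i = [a,b,c,d,e,f] ! (i - 1)"
    using relabel[OF xs(1) _ xs(2)] by auto
  have "\<sigma> (p i) = p (\<tau> i)" for i
  proof (cases "i \<in> {1..6}")
    case True
    then have "\<tau> i \<in> {1..6}" using permutes_in_image[OF \<tau>] by blast
    then show ?thesis using p(2) eq True by simp
  next
    case False
    then show ?thesis using permutes_not_in p(1) \<sigma> \<tau> by metis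
  qed
  then show thesis using that[OF p(1)] by (auto simp: fun_eq_iff)
qed

lemma ex_point_outside:
  assumes "finite C" "card C < 6"
  obtains y :: nat where "y \<in> {1..6}" "y \<notin> C"
proof -
  have "\<not> {1..6} \<subseteq> C" using card_mono[OF assms(1), of "{1..6}"] assms(2) by auto
  then show thesis using that by blast
qed

lemma atLeast1AtMost6_cases:
  assumes "i \<in> {1..6::nat}"
  obtains "i = 1" | "i = 2" | "i = 3" | "i = 4" | "i = 5" | "i = 6"
proof -
  have "i = 1 \<or> i = 2 \<or> i = 3 \<or> i = 4 \<or> i = 5 \<or> i = 6" using assms by (simp, linarith)
  then show thesis using that by blast
qed

definition cycles_222 :: "nat \<Rightarrow> nat" where
  "cycles_222 = transpose 1 2 \<circ> (transpose 3 4 \<circ> transpose 5 6)"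

definition cycles_33 :: "nat \<Rightarrow> nat" where
  "cycles_33 = cyc3 1 2 3 \<circ> cyc3 4 5 6"

text \<open>The product of transpositions is the cycle sending each \<open>i < 6\<close> to
  \<open>i + 1\<close> and 6 to 1.\<close>

definition cycles_6 :: "nat \<Rightarrow> nat" where
  "cycles_6 = transpose 1 2 \<circ> (transpose 2 3 \<circ> (transpose 3 4 \<circ> (transpose 4 5 \<circ> transpose 5 6)))"

lemma cycles_permutes: "cycles_222 permutes {1..6}" "cycles_33 permutes {1..6}" "cycles_6 permutes {1..6}"
  unfolding cycles_222_def cycles_33_def cycles_6_def
  by (intro permutes_compose permutes_swap_id cyc3_permutes; simp)+

text \<open>The outer automorphism turns these types into a transposition, a 3-cycle, and a 3-cycle
  times a disjoint transposition.\<close>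

lemma card_moved_totals:
  "card (Set.filter (\<lambda>T. act_total cycles_222 T \<noteq> T) totals) = 2"
  "card (Set.filter (\<lambda>T. act_total cycles_33 T \<noteq> T) totals) = 3"
  "card (Set.filter (\<lambda>T. act_total cycles_6 T \<noteq> T) totals) = 5"
  by code_simp+

lemma card_supp_outer_action_2:
  assumes \<sigma>: "\<sigma> permutes {1..6}" and "all_cycles_of_length 6 \<sigma> 2"
  shows "card (supp (outer_action \<sigma>)) = 2"
proof -
  have cyc: "\<sigma> (\<sigma> x) = x" "\<sigma> x \<noteq> x" if "x \<in> {1..6}" for x
    using assms(2) that unfolding all_cycles_of_length_def
    by (auto simp: eval_nat_numeral dest!: bspec[of _ _ x] spec[of _ 1])
  have inn: "\<sigma> x \<in> {1..6}" if "x \<in> {1..6}" for x using permutes_in_image[OF \<sigma>] that by blast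
  have inj: "\<sigma> u = \<sigma> v \<longleftrightarrow> u = v" for u v using permutes_inj[OF \<sigma>] by (simp add: inj_eq)
  define x :: nat where "x = 1"
  have x: "x \<in> {1..6}" by (simp add: x_def)
  obtain y where y: "y \<in> {1..6}" "y \<notin> {x, \<sigma> x}"
    by (rule ex_point_outside[of "{x, \<sigma> x}"]) (auto simp: card_insert_if)
  obtain z where z: "z \<in> {1..6}" "z \<notin> {x, \<sigma> x, y, \<sigma> y}"
    by (rule ex_point_outside[of "{x, \<sigma> x, y, \<sigma> y}"]) (auto simp: card_insert_if)
  have sw: "\<sigma> u = v \<longleftrightarrow> u = \<sigma> v" if "u \<in> {1..6}" "v \<in> {1..6}" for u v using cyc that by metis
  obtain p where "p permutes {1..6}" "\<sigma> \<circ> p = p \<circ> cycles_222"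
  proof (rule relabel_conj[OF \<sigma> _ _ cycles_permutes(1), of x "\<sigma> x" y "\<sigma> y" z "\<sigma> z"])
    show "distinct [x, \<sigma> x, y, \<sigma> y, z, \<sigma> z]"
      using y z cyc(2)[OF x] cyc(2)[OF y(1)] cyc(2)[OF z(1)] inj sw[OF x y(1)] sw[OF x z(1)] sw[OF y(1) z(1)] by auto
    show "set [x, \<sigma> x, y, \<sigma> y, z, \<sigma> z] \<subseteq> {1..6}" using x y z inn by auto
    fix i :: nat assume "i \<in> {1..6}"
    then show "\<sigma> ([x, \<sigma> x, y, \<sigma> y, z, \<sigma> z] ! (i - 1)) = [x, \<sigma> x, y, \<sigma> y, z, \<sigma> z] ! (cycles_222 i - 1)"
      by (cases rule: atLeast1AtMost6_cases)
        (simp_all add: cycles_222_def transpose_def cyc(1)[OF x] cyc(1)[OF y(1)] cyc(1)[OF z(1)] eval_nat_numeral)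
  qed
  then show ?thesis using card_supp_outer_action_conj card_moved_totals(1) by simp
qed

lemma card_supp_outer_action_3:
  assumes \<sigma>: "\<sigma> permutes {1..6}" and "all_cycles_of_length 6 \<sigma> 3"
  shows "card (supp (outer_action \<sigma>)) = 3"
proof -
  have cyc: "\<sigma> (\<sigma> (\<sigma> x)) = x" "\<sigma> x \<noteq> x" "\<sigma> (\<sigma> x) \<noteq> x" if "x \<in> {1..6}" for x
  proof -
    have "(\<sigma> ^^ 3) x = x" and ne: "\<And>j. 0 < j \<Longrightarrow> j < 3 \<Longrightarrow> (\<sigma> ^^ j) x \<noteq> x"
      using assms(2) that unfolding all_cycles_of_length_def by blast+
    then show "\<sigma> (\<sigma> (\<sigma> x)) = x" "\<sigma> x \<noteq> x" "\<sigma> (\<sigma> x) \<noteq> x"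
      using ne[of 1] ne[of 2] by (simp_all add: eval_nat_numeral)
  qed
  have inn: "\<sigma> x \<in> {1..6}" if "x \<in> {1..6}" for x using permutes_in_image[OF \<sigma>] that by blast
  have inj: "\<sigma> u = \<sigma> v \<longleftrightarrow> u = v" for u v using permutes_inj[OF \<sigma>] by (simp add: inj_eq)
  define x :: nat where "x = 1"
  have x: "x \<in> {1..6}" by (simp add: x_def)
  let ?C = "{x, \<sigma> x, \<sigma> (\<sigma> x)}"
  obtain y where y: "y \<in> {1..6}" "y \<notin> ?C"
    by (rule ex_point_outside[of ?C]) (auto simp: card_insert_if)
  \<comment> \<open>The first cycle is invariant, so the whole cycle of \<open>y\<close> is disjoint
    from it.\<close>
  have C: "\<sigma> v \<in> ?C \<longleftrightarrow> v \<in> ?C" for v using cyc(1)[OF x] inj by (metis insert_iff empty_iff)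
  have out: "\<sigma> y \<notin> ?C" "\<sigma> (\<sigma> y) \<notin> ?C" using C y by blast+
  obtain p where "p permutes {1..6}" "\<sigma> \<circ> p = p \<circ> cycles_33"
  proof (rule relabel_conj[OF \<sigma> _ _ cycles_permutes(2), of x "\<sigma> x" "\<sigma> (\<sigma> x)" y "\<sigma> y" "\<sigma> (\<sigma> y)"])
    show "distinct [x, \<sigma> x, \<sigma> (\<sigma> x), y, \<sigma> y, \<sigma> (\<sigma> y)]"
      using y out cyc(2,3)[OF x] cyc(2,3)[OF y(1)] inj by auto
    show "set [x, \<sigma> x, \<sigma> (\<sigma> x), y, \<sigma> y, \<sigma> (\<sigma> y)] \<subseteq> {1..6}" using x y inn by auto
    fix i :: nat assume "i \<in> {1..6}"
    then show "\<sigma> ([x, \<sigma> x, \<sigma> (\<sigma> x), y, \<sigma> y, \<sigma> (\<sigma> y)] ! (i - 1)) = [x, \<sigma> x, \<sigma> (\<sigma> x), y, \<sigma> y, \<sigma> (\<sigma> y)] ! (cycles_33 i - 1)"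
      by (cases rule: atLeast1AtMost6_cases)
        (simp_all add: cycles_33_def cyc3_def cyc(1)[OF x] cyc(1)[OF y(1)] eval_nat_numeral)
  qed
  then show ?thesis using card_supp_outer_action_conj card_moved_totals(2) by simp
qed

lemma card_supp_outer_action_6:
  assumes \<sigma>: "\<sigma> permutes {1..6}" and "all_cycles_of_length 6 \<sigma> 6"
  shows "card (supp (outer_action \<sigma>)) = 5"
proof -
  define x :: nat where "x = 1"
  have x: "x \<in> {1..6}" by (simp add: x_def)
  have "(\<sigma> ^^ 6) x = x" and ne: "\<And>j. 0 < j \<Longrightarrow> j < 6 \<Longrightarrow> (\<sigma> ^^ j) x \<noteq> x"
    using assms(2) x unfolding all_cycles_of_length_def by blast+
  then have c6: "\<sigma> (\<sigma> (\<sigma> (\<sigma> (\<sigma> (\<sigma> x))))) = x" by (simp add: eval_nat_numeral)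
  have ne': "\<sigma> x \<noteq> x" "\<sigma> (\<sigma> x) \<noteq> x" "\<sigma> (\<sigma> (\<sigma> x)) \<noteq> x" "\<sigma> (\<sigma> (\<sigma> (\<sigma> x))) \<noteq> x" "\<sigma> (\<sigma> (\<sigma> (\<sigma> (\<sigma> x)))) \<noteq> x"
    using ne[of 1] ne[of 2] ne[of 3] ne[of 4] ne[of 5] by (simp_all add: eval_nat_numeral)
  have inn: "\<sigma> x \<in> {1..6}" if "x \<in> {1..6}" for x using permutes_in_image[OF \<sigma>] that by blast
  have inj: "\<sigma> u = \<sigma> v \<longleftrightarrow> u = v" for u v using permutes_inj[OF \<sigma>] by (simp add: inj_eq)
  let ?xs = "[x, \<sigma> x, \<sigma> (\<sigma> x), \<sigma> (\<sigma> (\<sigma> x)), \<sigma> (\<sigma> (\<sigma> (\<sigma> x))), \<sigma> (\<sigma> (\<sigma> (\<sigma> (\<sigma> x))))]"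
  obtain p where "p permutes {1..6}" "\<sigma> \<circ> p = p \<circ> cycles_6"
  proof (rule relabel_conj[OF \<sigma> _ _ cycles_permutes(3)])
    show "distinct ?xs" using ne' ne'[symmetric] by (simp add: inj)
    show "set ?xs \<subseteq> {1..6}" using x inn by simp
    fix i :: nat assume "i \<in> {1..6}"
    then show "\<sigma> (?xs ! (i - 1)) = ?xs ! (cycles_6 i - 1)"
      by (cases rule: atLeast1AtMost6_cases)
        (simp_all add: cycles_6_def transpose_def c6 eval_nat_numeral)
  qed
  then show ?thesis using card_supp_outer_action_conj card_moved_totals(3) by simp
qed

section \<open>Minimal degrees in the generic and exceptional cases\<close>

theorem theorem2p18:
  fixes n :: nat and \<sigma> :: "nat \<Rightarrow> nat"
  assumes "n \<ge> 2" and "\<sigma> permutes {1..n}" and "\<sigma> \<noteq> id"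
  shows "min_partial_degree (rees_carrier n) (rees_mult \<sigma>) =
           (if n = 6 \<and> Fix n \<sigma> = {} \<and> all_cycles_of_length n \<sigma> 6 then 11
            else if n = 6 \<and> Fix n \<sigma> = {} \<and> all_cycles_of_length n \<sigma> 3 then 9
            else if n = 6 \<and> Fix n \<sigma> = {} \<and> all_cycles_of_length n \<sigma> 2 then 8
            else 2 * n - card (Fix n \<sigma>))
       \<and> min_total_degree (rees_carrier n) (rees_mult \<sigma>) =
           (if n = 6 \<and> Fix n \<sigma> = {} \<and> all_cycles_of_length n \<sigma> 6 then 11
            else if n = 6 \<and> Fix n \<sigma> = {} \<and> all_cycles_of_length n \<sigma> 3 then 9
            else if n = 6 \<and> Fix n \<sigma> = {} \<and> all_cycles_of_length n \<sigma> 2 then 8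
            else 2 * n - card (Fix n \<sigma>))"
proof -
  note \<sigma> = assms(2,3)
  let ?P = "\<lambda>d. min_partial_degree (rees_carrier n) (rees_mult \<sigma>) = d \<and>
    min_total_degree (rees_carrier n) (rees_mult \<sigma>) = d"
  have n0: "n > 0" using assms(1) by simp
  have S: "supp \<sigma> \<subseteq> {1..n}" using supp_permutes_subset[OF \<sigma>(1)] .
  have Fix: "Fix n \<sigma> = {1..n} - supp \<sigma>" by (auto simp: Fix_def in_supp_iff)
  have cf: "card (Fix n \<sigma>) = n - card (supp \<sigma>)"
    unfolding Fix using S finite_subset[OF S] by (simp add: card_Diff_subset)
  have "card (supp \<sigma>) \<le> n" using card_mono[OF _ S] by simp
  then have d: "2 * n - card (Fix n \<sigma>) = n + card (supp \<sigma>)" unfolding cf by linarith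
  \<comment> \<open>The six totals give the upper bound. Below, any faithful set has at least six
    points, and \<open>k\<close> moved points are guaranteed separately.\<close>
  have exc: "?P (6 + k)"
    if "n = 6" "card (supp (outer_action \<sigma>)) = k"
      and "\<And>Y \<theta>. faithful_sym_action 6 (Y::nat set) \<theta> \<Longrightarrow> k \<le> card (supp (\<theta> \<sigma>))" for k
  proof -
    have "6 + k \<le> card Y + card (supp (\<theta> \<sigma>))" if "faithful_sym_action n (Y::nat set) \<theta>" for Y \<theta>
      using faithful_sym_action.card_Y_ge[OF that assms(1)] \<open>n = 6\<close> that
        \<open>\<And>Y \<theta>. faithful_sym_action 6 (Y::nat set) \<theta> \<Longrightarrow> k \<le> card (supp (\<theta> \<sigma>))\<close>[of Y \<theta>] by simp
    then show ?thesis
      using min_degrees_eqI[OF \<sigma>, of totals outer_action "6 + k"] faithful_sym_action_outer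
        card_totals that(1,2) by simp
  qed
  \<comment> \<open>The point 1 lies on a cycle of length \<open>k\<close>, so no smaller positive
    power is trivial. This supplies the order conditions for the 6-cycle and for two
    3-cycles.\<close>
  have not_id: "\<sigma> ^^ j \<noteq> id" if "n = 6" "all_cycles_of_length n \<sigma> k" "0 < j" "j < k" for j k
  proof
    assume "\<sigma> ^^ j = id"
    then have "(\<sigma> ^^ j) 1 = 1" by simp
    moreover have "1 \<in> {1..n}" using n0 by simp
    ultimately show False using that unfolding all_cycles_of_length_def by blast
  qed
  consider (six) "n = 6" "all_cycles_of_length n \<sigma> 6" "Fix n \<sigma> = {}"
    | (three) "n = 6" "\<not> all_cycles_of_length n \<sigma> 6" "all_cycles_of_length n \<sigma> 3" "Fix n \<sigma> = {}"
    | (two) "n = 6" "\<not> all_cycles_of_length n \<sigma> 6" "\<not> all_cycles_of_length n \<sigma> 3" "all_cycles_of_length n \<sigma> 2" "Fix n \<sigma> = {}"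
    | (gen) "n = 6 \<and> Fix n \<sigma> = {} \<longrightarrow> \<not> all_cycles_of_length n \<sigma> 6 \<and> \<not> all_cycles_of_length n \<sigma> 3 \<and> \<not> all_cycles_of_length n \<sigma> 2"
    by blast
  then show ?thesis
  proof cases
    case six
    have "?P (6 + 5)"
    proof (rule exc[OF six(1)])
      show "card (supp (outer_action \<sigma>)) = 5" using card_supp_outer_action_6 six \<sigma>(1) by simp
      show "5 \<le> card (supp (\<theta> \<sigma>))" if "faithful_sym_action 6 (Y::nat set) \<theta>" for Y \<theta>
        using faithful_sym_action.card_supp_ge_5[OF that, of \<sigma>] not_id[OF six(1,2)] \<sigma>(1) six(1) by simp
    qed
    then show ?thesis using six by simp
  next
    case three
    have "?P (6 + 3)"
    proof (rule exc[OF three(1)])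
      show "card (supp (outer_action \<sigma>)) = 3" using card_supp_outer_action_3 three \<sigma>(1) by simp
      show "3 \<le> card (supp (\<theta> \<sigma>))" if "faithful_sym_action 6 (Y::nat set) \<theta>" for Y \<theta>
        using faithful_sym_action.card_supp_ge_3[OF that, of \<sigma>] not_id[OF three(1,3)] \<sigma>(1) three(1) by simp
    qed
    then show ?thesis using three by simp
  next
    case two
    have "?P (6 + 2)"
    proof (rule exc[OF two(1)])
      show "card (supp (outer_action \<sigma>)) = 2" using card_supp_outer_action_2 two \<sigma>(1) by simp
      show "2 \<le> card (supp (\<theta> \<sigma>))" if "faithful_sym_action 6 (Y::nat set) \<theta>" for Y \<theta>
        using faithful_sym_action.card_supp_ge_2[OF that, of \<sigma>] \<sigma> two(1) by simp
    qed
    then show ?thesis using two by simp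
  next
    case gen
    have "n + card (supp \<sigma>) \<le> card Y + card (supp (\<theta> \<sigma>))"
      if act: "faithful_sym_action n (Y::nat set) \<theta>" for Y \<theta>
    proof (cases "7 \<le> n")
      case True then show ?thesis using faithful_sym_action.degree_lower_bound_large[OF act] \<sigma> by blast
    next
      case False
      then have "n \<le> 6" by simp
      moreover have "\<not> all_cycles_of_length 6 \<sigma> 2 \<and> \<not> all_cycles_of_length 6 \<sigma> 3 \<and> \<not> all_cycles_of_length 6 \<sigma> 6"
        if "n = 6" "supp \<sigma> = {1..6}" using gen that Fix by simp
      ultimately have "card (supp \<sigma>) \<le> card (supp (\<theta> \<sigma>))"
        using faithful_sym_action.card_supp_le_small[OF act \<sigma>] by blast
      then show ?thesis using faithful_sym_action.card_Y_ge[OF act assms(1)] by simp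
    qed
    \<comment> \<open>Here the natural action on \<open>{1..n}\<close> attains the bound.\<close>
    then have "?P (n + card (supp \<sigma>))"
      using min_degrees_eqI[OF \<sigma> faithful_sym_action_natural, of "n + card (supp \<sigma>)"] by simp
    then show ?thesis using gen d by auto
  qed
qed

end
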